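(* Let $X$ be a complete separable ultrahomogeneous ultrametric space. The following are equivalent: (i) $X$ is approximately indivisible. (ii) $X=\widehat{\mathbf{B}}_S$ (up to isometry) for some finite or countable $S\subset\,]0,+\infty[$ on which the reverse linear ordering $>$ on $\mathbb{R}$ induces a well-ordering.
   Context: A metric space is ultrametric when $d(x,z)\leqslant\max(d(x,y),d(y,z))$ for all $x,y,z$; it is ultrahomogeneous when every isometry between finite subspaces extends to an isometry of the space onto itself. $\mathbf{B}_S$ is the ultrametric space of all finitely supported elements of $\mathbb{Q}^S$ with distance $d(x,y)=\max\{s\in S:x(s)\neq y(s)\}$ for $x\neq y$, and $\widehat{\mathbf{B}}_S$ is its metric completion. That $>$ induces a well-ordering on $S$ means that every nonempty subset of $S$ has a largest element. For $Y\subset X$ and $\varepsilon>0$ let $(Y)_\varepsilon=\{x\in X:\exists y\in Y\ d(x,y)\leqslant\varepsilon\}$. $X$ is $\varepsilon$-indivisible when for every integer $k\geqslant1$ and every $\chi:X\to\{0,\dots,k-1\}$ there are $i<k$ and a subspace $\widetilde X\subset X$ isometric to $X$ with $\widetilde X\subset(\chi^{-1}(\{i\}))_\varepsilon$. $X$ is approximately indivisible when it is $\varepsilon$-indivisible for every $\varepsilon>0$. *)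

theory Defs
  imports "HOL-Analysis.Analysis"
begin

section \<open>Isometries, ultrametric and ultrahomogeneous spaces\<close>

definition isometry :: "'a metric \<Rightarrow> 'b metric \<Rightarrow> ('a \<Rightarrow> 'b) \<Rightarrow> bool" where
  "isometry m m' f \<longleftrightarrow> bij_betw f (mspace m) (mspace m') \<and>
     (\<forall>x\<in>mspace m. \<forall>y\<in>mspace m. mdist m' (f x) (f y) = mdist m x y)"

definition isometric :: "'a metric \<Rightarrow> 'b metric \<Rightarrow> bool" where
  "isometric m m' \<longleftrightarrow> (\<exists>f. isometry m m' f)"

definition ultrametric :: "'a metric \<Rightarrow> bool" where
  "ultrametric m \<longleftrightarrow> (\<forall>x\<in>mspace m. \<forall>y\<in>mspace m. \<forall>z\<in>mspace m.
     mdist m x z \<le> max (mdist m x y) (mdist m y z))"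

definition ultrahomogeneous :: "'a metric \<Rightarrow> bool" where
  "ultrahomogeneous m \<longleftrightarrow> (\<forall>A B f. finite A \<and> finite B \<and> A \<subseteq> mspace m \<and> B \<subseteq> mspace m \<and>
     isometry (submetric m A) (submetric m B) f \<longrightarrow>
     (\<exists>g. isometry m m g \<and> (\<forall>x\<in>A. g x = f x)))"

section \<open>Approximate indivisibility\<close>

definition thickening :: "'a metric \<Rightarrow> 'a set \<Rightarrow> real \<Rightarrow> 'a set" where
  "thickening m Y \<epsilon> = {x \<in> mspace m. \<exists>y\<in>Y. mdist m x y \<le> \<epsilon>}"

definition eps_indivisible :: "real \<Rightarrow> 'a metric \<Rightarrow> bool" where
  "eps_indivisible \<epsilon> m \<longleftrightarrow> (\<forall>k\<ge>(1::nat). \<forall>c \<in> mspace m \<rightarrow> {..<k}.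
     (\<exists>i<k. \<exists>Y \<subseteq> mspace m. isometric (submetric m Y) m \<and>
        Y \<subseteq> thickening m {x \<in> mspace m. c x = i} \<epsilon>))"

definition approx_indivisible :: "'a metric \<Rightarrow> bool" where
  "approx_indivisible m \<longleftrightarrow> (\<forall>\<epsilon>>0. eps_indivisible \<epsilon> m)"

section \<open>The metric completion\<close>

text \<open>Equivalence classes of Cauchy sequences. The value 0 of the distance function off the
  carrier is only there because the type of metrics demands nonnegativity and symmetry
  everywhere.\<close>

definition mcauchy :: "'a metric \<Rightarrow> (nat \<Rightarrow> 'a) set" where
  "mcauchy m = {x. Metric_space.MCauchy (mspace m) (mdist m) x}"

definition mcauchy_rel :: "'a metric \<Rightarrow> ((nat \<Rightarrow> 'a) \<times> (nat \<Rightarrow> 'a)) set" where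
  "mcauchy_rel m = {(x, y) \<in> mcauchy m \<times> mcauchy m. (\<lambda>n. mdist m (x n) (y n)) \<longlonglongrightarrow> 0}"

definition completion_carrier :: "'a metric \<Rightarrow> (nat \<Rightarrow> 'a) set set" where
  "completion_carrier m = mcauchy m // mcauchy_rel m"

definition completion_dist :: "'a metric \<Rightarrow> (nat \<Rightarrow> 'a) set \<Rightarrow> (nat \<Rightarrow> 'a) set \<Rightarrow> real" where
  "completion_dist m a b =
     (if a \<in> completion_carrier m \<and> b \<in> completion_carrier m
      then (THE r. \<forall>x\<in>a. \<forall>y\<in>b. (\<lambda>n. mdist m (x n) (y n)) \<longlonglongrightarrow> r) else 0)"

definition metric_completion :: "'a metric \<Rightarrow> (nat \<Rightarrow> 'a) set metric" where
  "metric_completion m = metric (completion_carrier m, completion_dist m)"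

lemma mdist_self: "x \<in> mspace m \<Longrightarrow> mdist m x x = 0"
  by simp

lemma mdist_quad:
  assumes "x \<in> mspace m" "y \<in> mspace m" "x' \<in> mspace m" "y' \<in> mspace m"
  shows "\<bar>mdist m x y - mdist m x' y'\<bar> \<le> mdist m x x' + mdist m y y'"
  using mdist_triangle[of x m x' y] mdist_triangle[of x' m y' y]
    mdist_triangle[of x' m x y'] mdist_triangle[of x m y y'] assms
    mdist_commute[of m x x'] mdist_commute[of m y y']
  by linarith

lemma mcauchy_iff:
  "x \<in> mcauchy m \<longleftrightarrow> range x \<subseteq> mspace m \<and>
     (\<forall>\<epsilon>>0. \<exists>N. \<forall>n n'. N \<le> n \<longrightarrow> N \<le> n' \<longrightarrow> mdist m (x n) (x n') < \<epsilon>)"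
  unfolding mcauchy_def by (simp add: Metric_space.MCauchy_def[OF Metric_space_mspace_mdist])

lemma mcauchy_mspace: "x \<in> mcauchy m \<Longrightarrow> x n \<in> mspace m"
  by (auto simp: mcauchy_iff)

lemma mcauchy_convergent:
  assumes "x \<in> mcauchy m" "y \<in> mcauchy m"
  shows "convergent (\<lambda>n. mdist m (x n) (y n))"
proof -
  have "Cauchy (\<lambda>n. mdist m (x n) (y n))"
  proof (rule metric_CauchyI)
    fix e :: real assume "e > 0"
    then have e: "e/2 > 0" by simp
    obtain N1 where N1: "\<And>n n'. N1 \<le> n \<Longrightarrow> N1 \<le> n' \<Longrightarrow> mdist m (x n) (x n') < e/2"
      using assms(1) e unfolding mcauchy_iff by meson
    obtain N2 where N2: "\<And>n n'. N2 \<le> n \<Longrightarrow> N2 \<le> n' \<Longrightarrow> mdist m (y n) (y n') < e/2"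
      using assms(2) e unfolding mcauchy_iff by meson
    show "\<exists>M. \<forall>i\<ge>M. \<forall>j\<ge>M. dist (mdist m (x i) (y i)) (mdist m (x j) (y j)) < e"
    proof (intro exI[of _ "max N1 N2"] allI impI)
      fix i j assume "i \<ge> max N1 N2" "j \<ge> max N1 N2"
      then show "dist (mdist m (x i) (y i)) (mdist m (x j) (y j)) < e"
        using N1[of i j] N2[of i j] mdist_quad[of "x i" m "y i" "x j" "y j"] assms
        by (auto simp: dist_real_def mcauchy_mspace)
    qed
  qed
  then show ?thesis by (rule Cauchy_convergent)
qed

lemma equiv_mcauchy_rel: "equiv (mcauchy m) (mcauchy_rel m)"
proof (rule equivI)
  show "mcauchy_rel m \<subseteq> mcauchy m \<times> mcauchy m" by (auto simp: mcauchy_rel_def)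
  show "refl_on (mcauchy m) (mcauchy_rel m)"
    by (auto simp: refl_on_def mcauchy_rel_def mcauchy_mspace mdist_self)
  show "sym (mcauchy_rel m)"
    by (auto simp: sym_def mcauchy_rel_def mdist_commute)
  show "trans (mcauchy_rel m)"
  proof (rule transI)
    fix x y z assume xy: "(x, y) \<in> mcauchy_rel m" and yz: "(y, z) \<in> mcauchy_rel m"
    have lim: "(\<lambda>n. mdist m (x n) (y n) + mdist m (y n) (z n)) \<longlonglongrightarrow> 0"
      using xy yz tendsto_add[of _ 0 sequentially _ 0] unfolding mcauchy_rel_def by fastforce
    have "(\<lambda>n. mdist m (x n) (z n)) \<longlonglongrightarrow> 0"
      by (rule tendsto_sandwich[OF _ _ tendsto_const lim])
         (use xy yz in \<open>auto simp: mcauchy_rel_def mcauchy_mspace intro!: always_eventually mdist_triangle\<close>)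
    with xy yz show "(x, z) \<in> mcauchy_rel m" by (auto simp: mcauchy_rel_def)
  qed
qed

lemma mcauchy_class_in [intro]:
  "x \<in> mcauchy m \<Longrightarrow> mcauchy_rel m `` {x} \<in> completion_carrier m"
  unfolding completion_carrier_def by (rule quotientI)

lemma mcauchy_class_cases:
  assumes "a \<in> completion_carrier m"
  obtains x where "x \<in> mcauchy m" "a = mcauchy_rel m `` {x}"
  using assms unfolding completion_carrier_def by (rule quotientE)

lemma completion_dist_class:
  assumes "x \<in> mcauchy m" "y \<in> mcauchy m"
  shows "(\<lambda>n. mdist m (x n) (y n)) \<longlonglongrightarrow>
           completion_dist m (mcauchy_rel m `` {x}) (mcauchy_rel m `` {y})"
proof -
  let ?a = "mcauchy_rel m `` {x}" and ?b = "mcauchy_rel m `` {y}"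
  obtain r where r: "(\<lambda>n. mdist m (x n) (y n)) \<longlonglongrightarrow> r"
    using mcauchy_convergent[OF assms] unfolding convergent_def by blast
  have mem: "x \<in> ?a" "y \<in> ?b"
    using assms equiv_mcauchy_rel equiv_class_self by fast+
  have all: "(\<lambda>n. mdist m (x' n) (y' n)) \<longlonglongrightarrow> r" if "x' \<in> ?a" "y' \<in> ?b" for x' y'
  proof -
    have xy': "x' \<in> mcauchy m" "y' \<in> mcauchy m"
      and l: "(\<lambda>n. mdist m (x n) (x' n)) \<longlonglongrightarrow> 0" "(\<lambda>n. mdist m (y n) (y' n)) \<longlonglongrightarrow> 0"
      using that by (auto simp: mcauchy_rel_def)
    have lim: "(\<lambda>n. mdist m (x n) (x' n) + mdist m (y n) (y' n)) \<longlonglongrightarrow> 0"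
      using tendsto_add[OF l] by simp
    have "(\<lambda>n. mdist m (x n) (y n) - mdist m (x' n) (y' n)) \<longlonglongrightarrow> 0"
      by (rule Lim_null_comparison[OF _ lim])
         (use assms xy' in \<open>auto simp: mcauchy_mspace intro!: always_eventually mdist_quad\<close>)
    from tendsto_diff[OF r this] show ?thesis by simp
  qed
  have "(THE r. \<forall>x'\<in>?a. \<forall>y'\<in>?b. (\<lambda>n. mdist m (x' n) (y' n)) \<longlonglongrightarrow> r) = r"
  proof (rule the_equality)
    show "\<forall>x'\<in>?a. \<forall>y'\<in>?b. (\<lambda>n. mdist m (x' n) (y' n)) \<longlonglongrightarrow> r" using all by blast
    fix r' assume "\<forall>x'\<in>?a. \<forall>y'\<in>?b. (\<lambda>n. mdist m (x' n) (y' n)) \<longlonglongrightarrow> r'"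
    with mem have "(\<lambda>n. mdist m (x n) (y n)) \<longlonglongrightarrow> r'" by blast
    then show "r' = r" using r LIMSEQ_unique by blast
  qed
  then have "completion_dist m ?a ?b = r"
    using assms by (simp add: completion_dist_def mcauchy_class_in)
  with r show ?thesis by simp
qed

lemma Metric_space_completion: "Metric_space (completion_carrier m) (completion_dist m)"
proof
  fix a b
  show "0 \<le> completion_dist m a b"
  proof (cases "a \<in> completion_carrier m \<and> b \<in> completion_carrier m")
    case True
    then obtain x y where xy: "x \<in> mcauchy m" "a = mcauchy_rel m `` {x}"
      "y \<in> mcauchy m" "b = mcauchy_rel m `` {y}" by (meson mcauchy_class_cases)
    show ?thesis
      using LIMSEQ_le_const[OF completion_dist_class[OF xy(1,3)], of 0] xy by auto
  qed (auto simp: completion_dist_def)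
  show "completion_dist m a b = completion_dist m b a"
  proof (cases "a \<in> completion_carrier m \<and> b \<in> completion_carrier m")
    case True
    then obtain x y where xy: "x \<in> mcauchy m" "a = mcauchy_rel m `` {x}"
      "y \<in> mcauchy m" "b = mcauchy_rel m `` {y}" by (meson mcauchy_class_cases)
    show ?thesis
      using LIMSEQ_unique[OF completion_dist_class[OF xy(1,3)]]
        completion_dist_class[OF xy(3,1)] xy by (simp add: mdist_commute)
  qed (auto simp: completion_dist_def)
next
  fix a b assume "a \<in> completion_carrier m" "b \<in> completion_carrier m"
  then obtain x y where xy: "x \<in> mcauchy m" "a = mcauchy_rel m `` {x}"
    "y \<in> mcauchy m" "b = mcauchy_rel m `` {y}" by (meson mcauchy_class_cases)
  have "completion_dist m a b = 0 \<longleftrightarrow> (\<lambda>n. mdist m (x n) (y n)) \<longlonglongrightarrow> 0"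
    using completion_dist_class[OF xy(1,3)] xy LIMSEQ_unique by auto
  also have "\<dots> \<longleftrightarrow> (x, y) \<in> mcauchy_rel m" using xy by (simp add: mcauchy_rel_def)
  also have "\<dots> \<longleftrightarrow> a = b" using eq_equiv_class_iff[OF equiv_mcauchy_rel xy(1,3)] xy by simp
  finally show "completion_dist m a b = 0 \<longleftrightarrow> a = b" .
next
  fix a b c
  assume "a \<in> completion_carrier m" "b \<in> completion_carrier m" "c \<in> completion_carrier m"
  then obtain x y z where xyz: "x \<in> mcauchy m" "a = mcauchy_rel m `` {x}"
    "y \<in> mcauchy m" "b = mcauchy_rel m `` {y}" "z \<in> mcauchy m" "c = mcauchy_rel m `` {z}"
    by (meson mcauchy_class_cases)
  show "completion_dist m a c \<le> completion_dist m a b + completion_dist m b c"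
    using LIMSEQ_le[OF completion_dist_class[OF xyz(1,5)]
        tendsto_add[OF completion_dist_class[OF xyz(1,3)] completion_dist_class[OF xyz(3,5)]]]
      mdist_triangle[OF mcauchy_mspace mcauchy_mspace mcauchy_mspace, OF xyz(1,3,5)] xyz
    by auto
qed

lemma mspace_metric_completion [simp]: "mspace (metric_completion m) = completion_carrier m"
  unfolding metric_completion_def
  by (rule Metric_space.mspace_metric[OF Metric_space_completion])

lemma mdist_metric_completion [simp]: "mdist (metric_completion m) = completion_dist m"
  unfolding metric_completion_def
  by (rule Metric_space.mdist_metric[OF Metric_space_completion])

definition completion_embed :: "'a metric \<Rightarrow> 'a \<Rightarrow> (nat \<Rightarrow> 'a) set" where
  "completion_embed m x = mcauchy_rel m `` {\<lambda>n. x}"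

lemma mcauchy_const: "x \<in> mspace m \<Longrightarrow> (\<lambda>n. x) \<in> mcauchy m"
  by (auto simp: mcauchy_iff mdist_self)

lemma completion_embed_in: "x \<in> mspace m \<Longrightarrow> completion_embed m x \<in> completion_carrier m"
  unfolding completion_embed_def by (blast intro: mcauchy_const)

lemma completion_embed_dist:
  assumes "x \<in> mspace m" "y \<in> mspace m"
  shows "completion_dist m (completion_embed m x) (completion_embed m y) = mdist m x y"
  using LIMSEQ_unique[OF completion_dist_class[OF mcauchy_const mcauchy_const, OF assms]
      tendsto_const]
  by (simp add: completion_embed_def)

lemma completion_embed_lim:
  assumes "x \<in> mcauchy m"
  shows "(\<lambda>n. completion_dist m (completion_embed m (x n)) (mcauchy_rel m `` {x})) \<longlonglongrightarrow> 0"
proof (rule LIMSEQ_I)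
  fix e :: real assume "e > 0"
  then have e: "e/2 > 0" by simp
  obtain N where N: "\<And>n n'. N \<le> n \<Longrightarrow> N \<le> n' \<Longrightarrow> mdist m (x n) (x n') < e/2"
    using assms(1) e unfolding mcauchy_iff by meson
  show "\<exists>no. \<forall>n\<ge>no. norm (completion_dist m (completion_embed m (x n)) (mcauchy_rel m `` {x}) - 0) < e"
  proof (intro exI[of _ N] allI impI)
    fix n assume n: "n \<ge> N"
    have "completion_dist m (completion_embed m (x n)) (mcauchy_rel m `` {x}) \<le> e/2"
      using LIMSEQ_le_const2[OF completion_dist_class[OF mcauchy_const assms], of "x n" "e/2"]
        N n assms by (force simp: completion_embed_def mcauchy_mspace less_imp_le)
    then show "norm (completion_dist m (completion_embed m (x n)) (mcauchy_rel m `` {x}) - 0) < e"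
      using Metric_space.nonneg[OF Metric_space_completion, of m] \<open>e > 0\<close> by simp
  qed
qed

lemma completion_embed_dense:
  assumes "a \<in> completion_carrier m" "e > 0"
  obtains x where "x \<in> mspace m" "completion_dist m (completion_embed m x) a < e"
proof -
  obtain x where x: "x \<in> mcauchy m" "a = mcauchy_rel m `` {x}"
    using assms(1) mcauchy_class_cases by blast
  obtain n where "completion_dist m (completion_embed m (x n)) a < e"
    using order_tendstoD(2)[OF completion_embed_lim[OF x(1)] assms(2)] x
    by (auto simp: eventually_sequentially)
  then show thesis using that x mcauchy_mspace by metis
qed

lemma mcomplete_metric_completion: "mcomplete_of (metric_completion m)"
proof -
  interpret C: Metric_space "completion_carrier m" "completion_dist m"
    by (rule Metric_space_completion)
  have "C.mcomplete"
    unfolding C.mcomplete_def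
  proof (intro allI impI)
    fix \<sigma> assume \<sigma>: "C.MCauchy \<sigma>"
    then have \<sigma>in: "\<sigma> n \<in> completion_carrier m" for n by (auto simp: C.MCauchy_def)
    have "\<forall>n. \<exists>x\<in>mspace m. completion_dist m (completion_embed m x) (\<sigma> n) < 1 / real (Suc n)"
      using completion_embed_dense[OF \<sigma>in] by (metis of_nat_0_less_iff zero_less_Suc zero_less_divide_1_iff)
    then obtain x where xin: "\<And>n. x n \<in> mspace m"
      and xd: "\<And>n. completion_dist m (completion_embed m (x n)) (\<sigma> n) < 1 / real (Suc n)"
      by metis
    have small: "\<exists>N. \<forall>n\<ge>N. 1 / real (Suc n) < e" if "e > 0" for e
      using order_tendstoD(2)[OF LIMSEQ_inverse_real_of_nat that]
      by (simp add: eventually_sequentially inverse_eq_divide)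
    note ein = completion_embed_in[OF xin]
    have xc: "x \<in> mcauchy m"
      unfolding mcauchy_iff
    proof (intro conjI allI impI)
      show "range x \<subseteq> mspace m" using xin by blast
      fix e :: real assume "e > 0"
      then have e: "e/3 > 0" by simp
      obtain N1 where N1: "\<And>n n'. N1 \<le> n \<Longrightarrow> N1 \<le> n' \<Longrightarrow> completion_dist m (\<sigma> n) (\<sigma> n') < e/3"
        using \<sigma> e unfolding C.MCauchy_def by meson
      obtain N2 where N2: "\<And>n. n \<ge> N2 \<Longrightarrow> 1 / real (Suc n) < e/3" using small[OF e] by blast
      show "\<exists>N. \<forall>n n'. N \<le> n \<longrightarrow> N \<le> n' \<longrightarrow> mdist m (x n) (x n') < e"
      proof (intro exI[of _ "max N1 N2"] allI impI)
        fix n n' assume n: "max N1 N2 \<le> n" "max N1 N2 \<le> n'"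
        have "mdist m (x n) (x n') =
            completion_dist m (completion_embed m (x n)) (completion_embed m (x n'))"
          by (simp add: completion_embed_dist xin)
        also have "\<dots> < e"
          using C.triangle[OF ein[of n] \<sigma>in[of n] ein[of n']]
            C.triangle[OF \<sigma>in[of n] \<sigma>in[of n'] ein[of n']]
            C.commute[of "completion_embed m (x n')" "\<sigma> n'"]
            xd[of n] xd[of n'] N1[of n n'] N2[of n] N2[of n'] n by simp
        finally show "mdist m (x n) (x n') < e" .
      qed
    qed
    let ?a = "mcauchy_rel m `` {x}"
    have ain: "?a \<in> completion_carrier m" using xc by blast
    have lim: "(\<lambda>n. 1 / real (Suc n) +
        completion_dist m (completion_embed m (x n)) ?a) \<longlonglongrightarrow> 0"
      using tendsto_add[OF LIMSEQ_inverse_real_of_nat completion_embed_lim[OF xc]]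
      by (simp add: inverse_eq_divide)
    have "(\<lambda>n. completion_dist m (\<sigma> n) ?a) \<longlonglongrightarrow> 0"
    proof (rule tendsto_sandwich[OF _ _ tendsto_const lim])
      show "\<forall>\<^sub>F n in sequentially. completion_dist m (\<sigma> n) ?a
          \<le> 1 / real (Suc n) + completion_dist m (completion_embed m (x n)) ?a"
      proof (intro always_eventually allI)
        fix n
        show "completion_dist m (\<sigma> n) ?a
          \<le> 1 / real (Suc n) + completion_dist m (completion_embed m (x n)) ?a"
          using C.triangle[OF \<sigma>in[of n] ein[of n] ain] xd[of n]
            C.commute[of "completion_embed m (x n)" "\<sigma> n"] by linarith
      qed
    qed simp
    then show "\<exists>a. limitin C.mtopology \<sigma> a sequentially"
      using ain \<sigma>in by (intro exI[of _ ?a]) (simp add: C.limitin_metric_dist_null)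
  qed
  then show ?thesis by (simp add: mcomplete_of_def)
qed

section \<open>The spaces \<open>B\<^sub>S\<close>\<close>

text \<open>An element of \<open>\<rat>\<^sup>S\<close> is represented by the function on the reals that extends it by zero.\<close>

definition B_carrier :: "real set \<Rightarrow> (real \<Rightarrow> rat) set" where
  "B_carrier S = {x. {s. x s \<noteq> 0} \<subseteq> S \<and> finite {s. x s \<noteq> 0}}"

definition B_dist :: "real set \<Rightarrow> (real \<Rightarrow> rat) \<Rightarrow> (real \<Rightarrow> rat) \<Rightarrow> real" where
  "B_dist S x y =
     (if x \<in> B_carrier S \<and> y \<in> B_carrier S \<and> x \<noteq> y then Max {s \<in> S. x s \<noteq> y s} else 0)"

definition B_space :: "real set \<Rightarrow> (real \<Rightarrow> rat) metric" where
  "B_space S = metric (B_carrier S, B_dist S)"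

text \<open>The distance above is a metric only for sets of positive reals.\<close>

lemma B_diff:
  assumes "x \<in> B_carrier S" "y \<in> B_carrier S"
  shows "finite {s \<in> S. x s \<noteq> y s}" "{s \<in> S. x s \<noteq> y s} = {s. x s \<noteq> y s}"
proof -
  show "finite {s \<in> S. x s \<noteq> y s}"
    by (rule finite_subset[of _ "{s. x s \<noteq> 0} \<union> {s. y s \<noteq> 0}"])
       (use assms in \<open>auto simp: B_carrier_def\<close>)
  have "s \<in> S" if "x s \<noteq> y s" for s
  proof (rule ccontr)
    assume "s \<notin> S"
    then have "x s = 0" "y s = 0" using assms by (auto simp: B_carrier_def)
    with that show False by simp
  qed
  then show "{s \<in> S. x s \<noteq> y s} = {s. x s \<noteq> y s}" by blast
qed

lemma B_dist_Max:
  assumes "x \<in> B_carrier S" "y \<in> B_carrier S" "x \<noteq> y"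
  shows "B_dist S x y \<in> S" "x (B_dist S x y) \<noteq> y (B_dist S x y)"
    "\<And>s. x s \<noteq> y s \<Longrightarrow> s \<le> B_dist S x y"
proof -
  let ?D = "{s \<in> S. x s \<noteq> y s}"
  have ne: "?D \<noteq> {}" using B_diff(2)[OF assms(1,2)] assms(3) by auto
  have eq: "B_dist S x y = Max ?D" using assms by (simp add: B_dist_def)
  show "B_dist S x y \<in> S" "x (B_dist S x y) \<noteq> y (B_dist S x y)"
    using Max_in[OF B_diff(1)[OF assms(1,2)] ne] eq by auto
  show "s \<le> B_dist S x y" if "x s \<noteq> y s" for s
    using Max_ge[OF B_diff(1)[OF assms(1,2)], of s] B_diff(2)[OF assms(1,2)] that eq by auto
qed

lemma B_dist_nonneg: "S \<subseteq> {0<..} \<Longrightarrow> 0 \<le> B_dist S x y"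
  using B_dist_Max(1)[of x S y] by (force simp: B_dist_def less_imp_le)

lemma B_dist_ultra:
  assumes "S \<subseteq> {0<..}" "x \<in> B_carrier S" "y \<in> B_carrier S" "z \<in> B_carrier S"
  shows "B_dist S x z \<le> max (B_dist S x y) (B_dist S y z)"
proof (cases "x = z \<or> x = y \<or> y = z")
  case True
  moreover have "B_dist S y y = 0" for y by (simp add: B_dist_def)
  ultimately show ?thesis using B_dist_nonneg[OF assms(1)] by (auto simp: le_max_iff_disj)
next
  case False
  then show ?thesis
    using B_dist_Max[of x S z] B_dist_Max(3)[of x S y] B_dist_Max(3)[of y S z] assms
    by (metis le_max_iff_disj)
qed

lemma Metric_space_B:
  assumes "S \<subseteq> {0<..}"
  shows "Metric_space (B_carrier S) (B_dist S)"
proof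
  fix x y
  show "0 \<le> B_dist S x y" by (rule B_dist_nonneg[OF assms])
  have "{s \<in> S. x s \<noteq> y s} = {s \<in> S. y s \<noteq> x s}" by auto
  then show "B_dist S x y = B_dist S y x" by (auto simp: B_dist_def)
next
  fix x y assume "x \<in> B_carrier S" "y \<in> B_carrier S"
  then show "B_dist S x y = 0 \<longleftrightarrow> x = y"
    using B_dist_Max(1)[of x S y] assms by (force simp: B_dist_def)
next
  fix x y z assume "x \<in> B_carrier S" "y \<in> B_carrier S" "z \<in> B_carrier S"
  from B_dist_ultra[OF assms this]
  show "B_dist S x z \<le> B_dist S x y + B_dist S y z"
    using B_dist_nonneg[OF assms, of x y] B_dist_nonneg[OF assms, of y z] by linarith
qed

lemma mspace_B_space [simp]: "S \<subseteq> {0<..} \<Longrightarrow> mspace (B_space S) = B_carrier S"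
  unfolding B_space_def by (rule Metric_space.mspace_metric[OF Metric_space_B])

lemma mdist_B_space [simp]: "S \<subseteq> {0<..} \<Longrightarrow> mdist (B_space S) = B_dist S"
  unfolding B_space_def by (rule Metric_space.mdist_metric[OF Metric_space_B])

definition reverse_well_ordered :: "real set \<Rightarrow> bool" where
  "reverse_well_ordered S \<longleftrightarrow> (\<forall>T\<subseteq>S. T \<noteq> {} \<longrightarrow> (\<exists>t\<in>T. \<forall>s\<in>T. s \<le> t))"

end

theory Submission
  imports Defs
begin

text \<open>
Call an ultrametric space generic over a set \<open>S\<close> of positive reals if its nonzero distances lie
in \<open>S\<close> and every closed ball of radius \<open>s \<in> S\<close> falls apart into infinitely many open balls of
radius \<open>s\<close>. A back-and-forth argument shows that a complete separable space that is generic over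
\<open>S\<close> is unique up to isometry (\<open>generic_unique\<close>). The space \<open>B\<^sub>S\<close> is generic over \<open>S\<close>, and
genericity passes to completions, so for countable \<open>S\<close> the completion of \<open>B\<^sub>S\<close> is that unique
space. The theorem thus says that \<open>X\<close> is approximately indivisible exactly if it is generic over a set
whose nonempty subsets have maxima.

Let \<open>X\<close> be approximately indivisible, and let \<open>S\<close> be its set of distances. If some closed ball of
radius \<open>s\<close> consisted of finitely many open balls of radius \<open>s\<close>, then by homogeneity so would all
of them, with the same number of pieces. Colouring a point by the number of its piece would keep
any two points of a nearly monochromatic copy from having distance \<open>s\<close>
(\<open>branching_if_approx_indivisible\<close>). If \<open>S\<close> contained an increasing sequence \<open>s\<^sub>0 < s\<^sub>1 < \<dots>\<close>, one
could choose a base point in each class of points joined by distances below the supremum, and colour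
a point by the parity of the first \<open>n\<close> for which its distance to the base point is at most
\<open>s\<^sub>n\<close>. A point of a copy of \<open>X\<close> has, within the copy, points at each distance
\<open>s\<^sub>n\<close>; for large \<open>n\<close> these are at distance \<open>s\<^sub>n\<close> from the base point too, so the copy takes both
colours (\<open>reverse_well_ordered_if_approx_indivisible\<close>).

Conversely, let \<open>X\<close> be generic over a reverse well-ordered \<open>S\<close>. One representative for each closed
ball of radius \<open>\<epsilon>\<close> gives a space generic over \<open>S \<inter> ]\<epsilon>,\<infinity>[\<close>, and it suffices to find in it a
monochromatic subset with the same branching: by uniqueness, the \<open>\<epsilon>\<close>-thickening of that set is a copy
of \<open>X\<close>. For two colours, red and blue, such a set comes from a dichotomy (\<open>branching_dichotomy\<close>).
Call an open ball rich if it contains a nonempty red branching set. If every blue point of a ball lies in a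
smaller closed ball almost all of whose pieces are rich, then the maximal such closed balls, which
exist because \<open>S\<close> is reverse well-ordered, are pairwise disjoint, and replacing the content of each
by red branching sets makes the big ball rich. Hence a ball that is not rich contains a blue point
all of whose smaller balls have infinitely many pieces that are not rich, and the points of this kind
form a blue branching set.
\<close>

section \<open>Branching subsets of ultrametric spaces\<close>

lemma ultra_le:
  assumes "ultrametric m" "x \<in> mspace m" "y \<in> mspace m" "z \<in> mspace m"
    and "mdist m x y \<le> r" "mdist m y z \<le> r"
  shows "mdist m x z \<le> r"
  using assms unfolding ultrametric_def by (meson max.bounded_iff order_trans)

lemma ultra_less:
  assumes "ultrametric m" "x \<in> mspace m" "y \<in> mspace m" "z \<in> mspace m"
    and "mdist m x y < r" "mdist m y z < r"
  shows "mdist m x z < r"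
  using assms unfolding ultrametric_def by (meson max_less_iff_conj le_less_trans)

lemma ultra_isosceles:
  assumes "ultrametric m" "x \<in> mspace m" "y \<in> mspace m" "z \<in> mspace m"
    and "mdist m x y < r" "mdist m y z = r"
  shows "mdist m x z = r"
proof (rule antisym)
  show "mdist m x z \<le> r"
    using ultra_le[of m x y z r] assms by simp
  show "r \<le> mdist m x z"
    using ultra_less[of m y x z r] assms by (force simp: mdist_commute)
qed

text \<open>Infinitely many open balls of radius \<open>s\<close> inside the closed ball around \<open>y\<close> meet \<open>Y\<close>: no finite set
\<open>A\<close> of points of the closed ball comes closer than \<open>s\<close> to all points of \<open>Y\<close> in that ball. This form avoids
counting balls and is the extension property that back-and-forth needs. The points of \<open>A\<close> may
lie outside \<open>Y\<close>, so that unions of branching sets are branching.\<close>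

definition branching :: "'a metric \<Rightarrow> real set \<Rightarrow> 'a set \<Rightarrow> bool" where
  "branching m T Y \<longleftrightarrow> (\<forall>y\<in>Y. \<forall>s\<in>T. \<forall>A. finite A \<longrightarrow> A \<subseteq> mspace m \<longrightarrow>
     (\<forall>a\<in>A. mdist m y a \<le> s) \<longrightarrow> (\<exists>z\<in>Y. \<forall>a\<in>insert y A. mdist m z a = s))"

lemma branching_ex:
  assumes "branching m T Y" "y \<in> Y" "s \<in> T" "finite A" "A \<subseteq> mspace m"
    "\<forall>a\<in>A. mdist m y a \<le> s"
  shows "\<exists>z\<in>Y. \<forall>a\<in>insert y A. mdist m z a = s"
  using assms unfolding branching_def by blast

lemma branchingD:
  assumes "branching m T Y" "y \<in> Y" "s \<in> T" "finite A" "A \<subseteq> mspace m"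
    "\<And>a. a \<in> A \<Longrightarrow> mdist m y a \<le> s"
  obtains z where "z \<in> Y" "mdist m z y = s" "\<And>a. a \<in> A \<Longrightarrow> mdist m z a = s"
  using assms unfolding branching_def by (metis insert_iff)

definition generic :: "real set \<Rightarrow> 'a metric \<Rightarrow> bool" where
  "generic S m \<longleftrightarrow> ultrametric m \<and> branching m S (mspace m) \<and>
     (\<forall>x\<in>mspace m. \<forall>y\<in>mspace m. x \<noteq> y \<longrightarrow> mdist m x y \<in> S)"

definition countably_dense :: "'a metric \<Rightarrow> bool" where
  "countably_dense m \<longleftrightarrow> (\<exists>D \<subseteq> mspace m. countable D \<and>
     (\<forall>x\<in>mspace m. \<forall>e>0. \<exists>a\<in>D. mdist m x a < e))"

section \<open>Uniqueness by back-and-forth\<close>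

definition partial_isometry :: "'a metric \<Rightarrow> 'b metric \<Rightarrow> ('a \<times> 'b) set \<Rightarrow> bool" where
  "partial_isometry m m' G \<longleftrightarrow> G \<subseteq> mspace m \<times> mspace m' \<and>
     (\<forall>(x, y)\<in>G. \<forall>(x', y')\<in>G. mdist m x x' = mdist m' y y')"

lemma partial_isometry_converse:
  "partial_isometry m m' G \<Longrightarrow> partial_isometry m' m (G\<inverse>)"
  unfolding partial_isometry_def by fastforce

text \<open>One step of back-and-forth. If \<open>s\<close> is the distance from \<open>x\<close> to a nearest point \<open>a0\<close> of the domain, the
image of \<open>x\<close> only has to be at distance \<open>s\<close> from the images of all nearest points, which branching
provides: a point farther from \<open>x\<close> than \<open>s\<close> has the same distance to \<open>x\<close> as to \<open>a0\<close>, and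
likewise on the side of the images.\<close>

lemma partial_isometry_extend:
  assumes g: "generic S m" and g': "generic S m'" and ne: "mspace m' \<noteq> {}"
    and G: "finite G" "partial_isometry m m' G" and x: "x \<in> mspace m"
  obtains y where "partial_isometry m m' (insert (x, y) G)"
proof (cases "G = {}")
  case True
  obtain y where "y \<in> mspace m'" using ne by blast
  with True x that[of y] show thesis by (simp add: partial_isometry_def mdist_self)
next
  case False
  have u: "ultrametric m" "ultrametric m'" using g g' by (auto simp: generic_def)
  have GM: "a \<in> mspace m" "b \<in> mspace m'" if "(a, b) \<in> G" for a b
    using G that by (auto simp: partial_isometry_def)
  have Gd: "mdist m a a' = mdist m' b b'" if "(a, b) \<in> G" "(a', b') \<in> G" for a b a' b'
    using G that by (fastforce simp: partial_isometry_def)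
  obtain a0 b0 where ab0: "(a0, b0) \<in> G"
    and min: "\<And>a b. (a, b) \<in> G \<Longrightarrow> mdist m x a0 \<le> mdist m x a"
  proof -
    obtain p where "p \<in> G" "\<And>q. q \<in> G \<Longrightarrow> mdist m x (fst p) \<le> mdist m x (fst q)"
      using ex_min_if_finite[of "(\<lambda>q. mdist m x (fst q)) ` G"] G False
      by (force simp: not_less)
    then show thesis using that[of "fst p" "snd p"] by force
  qed
  define s where "s = mdist m x a0"
  show thesis
  proof (cases "x = a0")
    case True
    with that[of b0] ab0 G show thesis by (simp add: insert_absorb)
  next
    case False
    have sS: "s \<in> S" using g x GM(1)[OF ab0] False by (auto simp: generic_def s_def)
    define A where "A = {b. \<exists>a. (a, b) \<in> G \<and> mdist m x a = s}"
    have "A \<subseteq> snd ` G" by (force simp: A_def)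
    then have Af: "finite A" using G finite_surj by auto
    have AM: "A \<subseteq> mspace m'" using GM by (auto simp: A_def)
    have Ad: "mdist m' b0 b \<le> s" if "b \<in> A" for b
    proof -
      obtain a where a: "(a, b) \<in> G" "mdist m x a = s" using \<open>b \<in> A\<close> by (auto simp: A_def)
      have "mdist m a0 a \<le> s"
        using ultra_le[OF u(1) GM(1)[OF ab0] x GM(1)[OF a(1)], of s] a
        by (simp add: s_def mdist_commute)
      with Gd[OF ab0 a(1)] show ?thesis by simp
    qed
    obtain y where y: "y \<in> mspace m'" "mdist m' y b0 = s"
      and yA: "\<And>b. b \<in> A \<Longrightarrow> mdist m' y b = s"
      using branchingD[of m' S "mspace m'" b0 s A] g' GM(2)[OF ab0] sS Af AM Ad
      by (auto simp: generic_def)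
    have key: "mdist m x a = mdist m' y b" if ab: "(a, b) \<in> G" for a b
    proof (cases "mdist m x a = s")
      case True
      with ab have "b \<in> A" unfolding A_def by blast
      with yA True show ?thesis by simp
    next
      case False
      with min[OF ab] have lt: "s < mdist m x a" by (simp add: s_def)
      have "mdist m a0 a = mdist m x a"
        using ultra_isosceles[OF u(1) GM(1)[OF ab0] x GM(1)[OF ab]] lt
        by (simp add: s_def mdist_commute)
      then have "mdist m' b0 b = mdist m x a" using Gd[OF ab0 ab] by simp
      then show ?thesis
        using ultra_isosceles[OF u(2) y(1) GM(2)[OF ab0] GM(2)[OF ab]] lt y by simp
    qed
    have "partial_isometry m m' (insert (x, y) G)"
      unfolding partial_isometry_def using GM Gd key x y
      by (auto simp: mdist_commute mdist_self)
    then show thesis by (rule that)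
  qed
qed

text \<open>The images of points converging to \<open>x\<close> form a Cauchy sequence; \<open>y\<close> is its limit.\<close>

lemma dense_partial_isometry_extends:
  assumes G: "partial_isometry m m' G" and c: "mcomplete_of m'" and x: "x \<in> mspace m"
    and dense: "\<And>e. e > 0 \<Longrightarrow> \<exists>(a, b)\<in>G. mdist m x a < e"
  obtains y where "y \<in> mspace m'" "\<And>e. e > 0 \<Longrightarrow> \<exists>(a, b)\<in>G. mdist m x a < e \<and> mdist m' y b < e"
proof -
  interpret M: Metric_space "mspace m'" "mdist m'" by (rule Metric_space_mspace_mdist)
  have GM: "a \<in> mspace m" "b \<in> mspace m'" if "(a, b) \<in> G" for a b
    using G that by (auto simp: partial_isometry_def)
  have Gd: "mdist m a a' = mdist m' b b'" if "(a, b) \<in> G" "(a', b') \<in> G" for a b a' b'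
    using G that by (fastforce simp: partial_isometry_def)
  have "\<forall>n. \<exists>p. p \<in> G \<and> mdist m x (fst p) < 1 / real (Suc n)"
    using dense by (metis case_prod_beta' of_nat_0_less_iff zero_less_Suc zero_less_divide_1_iff)
  then obtain p where p: "\<And>n. p n \<in> G" "\<And>n. mdist m x (fst (p n)) < 1 / real (Suc n)"
    by metis
  have pM: "fst (p n) \<in> mspace m" "snd (p n) \<in> mspace m'" for n
    using GM[of "fst (p n)" "snd (p n)"] p(1) by auto
  have small: "\<exists>N. \<forall>n\<ge>N. 1 / real (Suc n) < e" if "e > 0" for e
    using order_tendstoD(2)[OF LIMSEQ_inverse_real_of_nat that]
    by (simp add: eventually_sequentially inverse_eq_divide)
  have "M.MCauchy (\<lambda>n. snd (p n))"
    unfolding M.MCauchy_def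
  proof (intro conjI allI impI)
    fix e :: real assume "e > 0"
    then have "e/2 > 0" by simp
    from small[OF this] obtain N where N: "\<And>n. n \<ge> N \<Longrightarrow> 1 / real (Suc n) < e/2" by blast
    show "\<exists>N. \<forall>n n'. N \<le> n \<longrightarrow> N \<le> n' \<longrightarrow> mdist m' (snd (p n)) (snd (p n')) < e"
    proof (intro exI[of _ N] allI impI)
      fix n n' assume n: "N \<le> n" "N \<le> n'"
      have "mdist m (fst (p n)) (fst (p n')) < e"
        using mdist_triangle[OF pM(1)[of n] x pM(1)[of n']] p(2)[of n] p(2)[of n'] N[of n] N[of n'] n
        by (simp add: mdist_commute)
      then show "mdist m' (snd (p n)) (snd (p n')) < e"
        using Gd[of "fst (p n)" "snd (p n)" "fst (p n')" "snd (p n')"] p(1) by simp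
    qed
  qed (use pM in auto)
  then obtain y where y: "limitin M.mtopology (\<lambda>n. snd (p n)) y sequentially"
    using c unfolding mcomplete_of_def M.mcomplete_def by blast
  then have yM: "y \<in> mspace m'" by (simp add: M.limitin_metric_dist_null)
  show thesis
  proof (rule that[OF yM])
    fix e :: real assume e: "e > 0"
    have "\<forall>\<^sub>F n in sequentially. mdist m' (snd (p n)) y < e"
      using y e unfolding M.limitin_metric_dist_null by (auto dest: order_tendstoD(2))
    moreover have "\<forall>\<^sub>F n in sequentially. 1 / real (Suc n) < e"
      using small[OF e] by (simp add: eventually_sequentially)
    ultimately have "\<forall>\<^sub>F n in sequentially. mdist m' (snd (p n)) y < e \<and> 1 / real (Suc n) < e"
      by eventually_elim simp
    then obtain n where "mdist m' (snd (p n)) y < e" "1 / real (Suc n) < e"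
      by (auto simp: eventually_sequentially)
    then have "mdist m x (fst (p n)) < e \<and> mdist m' y (snd (p n)) < e"
      using p(2)[of n] by (simp add: mdist_commute)
    with p(1)[of n] show "\<exists>(a, b)\<in>G. mdist m x a < e \<and> mdist m' y b < e"
      by (auto intro!: bexI[of _ "p n"] simp: case_prod_beta)
  qed
qed

text \<open>The closure of the graph is the graph of an isometry; completeness of either space makes it total in the
respective direction.\<close>

lemma isometry_of_dense_partial_isometry:
  assumes G: "partial_isometry m m' G" and c: "mcomplete_of m" "mcomplete_of m'"
    and dense: "\<And>x e. x \<in> mspace m \<Longrightarrow> e > 0 \<Longrightarrow> \<exists>(a, b)\<in>G. mdist m x a < e"
    and dense': "\<And>y e. y \<in> mspace m' \<Longrightarrow> e > 0 \<Longrightarrow> \<exists>(a, b)\<in>G. mdist m' y b < e"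
  shows "isometric m m'"
proof -
  define R where "R x y \<longleftrightarrow> x \<in> mspace m \<and> y \<in> mspace m' \<and>
    (\<forall>e>0. \<exists>(a, b)\<in>G. mdist m x a < e \<and> mdist m' y b < e)" for x y
  have ex: "\<exists>y. R x y" if "x \<in> mspace m" for x
    using dense_partial_isometry_extends[OF G c(2) that dense[OF that]] that
    unfolding R_def by metis
  have ex': "\<exists>x. R x y" if y: "y \<in> mspace m'" for y
  proof -
    have dense_y: "\<exists>(b, a)\<in>G\<inverse>. mdist m' y b < e" if "e > 0" for e
      using dense'[OF y that] by fast
    obtain x where x: "x \<in> mspace m"
      and xy: "\<And>e. e > 0 \<Longrightarrow> \<exists>(b, a)\<in>G\<inverse>. mdist m' y b < e \<and> mdist m x a < e"
      using dense_partial_isometry_extends[OF partial_isometry_converse[OF G] c(1) y]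
        dense_y by metis
    have "\<exists>(a, b)\<in>G. mdist m x a < e \<and> mdist m' y b < e" if "e > 0" for e
      using xy[OF that] by blast
    with x y show ?thesis unfolding R_def by blast
  qed
  have eq: "mdist m x x' = mdist m' y y'" if R: "R x y" "R x' y'" for x y x' y'
  proof (rule ccontr)
    define e where "e = \<bar>mdist m x x' - mdist m' y y'\<bar> / 4"
    assume "mdist m x x' \<noteq> mdist m' y y'"
    then have e: "e > 0" by (simp add: e_def)
    obtain a b where ab: "(a, b) \<in> G" "mdist m x a < e" "mdist m' y b < e"
      using R(1) e unfolding R_def by fast
    obtain a' b' where ab': "(a', b') \<in> G" "mdist m x' a' < e" "mdist m' y' b' < e"
      using R(2) e unfolding R_def by fast
    have GM: "a \<in> mspace m" "b \<in> mspace m'" "a' \<in> mspace m" "b' \<in> mspace m'"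
      and "mdist m a a' = mdist m' b b'"
      using G ab(1) ab'(1) by (auto simp: partial_isometry_def)
    moreover have "\<bar>mdist m x x' - mdist m a a'\<bar> \<le> mdist m x a + mdist m x' a'"
      using R GM by (intro mdist_quad) (auto simp: R_def)
    moreover have "\<bar>mdist m' y y' - mdist m' b b'\<bar> \<le> mdist m' y b + mdist m' y' b'"
      using R GM by (intro mdist_quad) (auto simp: R_def)
    ultimately have "\<bar>mdist m x x' - mdist m' y y'\<bar>
        \<le> mdist m x a + mdist m x' a' + (mdist m' y b + mdist m' y' b')"
      by linarith
    also have "\<dots> < 4 * e" using ab ab' by linarith
    finally show False by (simp add: e_def)
  qed
  define f where "f x = (SOME y. R x y)" for x
  have f: "R x (f x)" if "x \<in> mspace m" for x
    unfolding f_def using ex[OF that] by (rule someI_ex)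
  have d: "mdist m' (f x) (f x') = mdist m x x'" if "x \<in> mspace m" "x' \<in> mspace m" for x x'
    using eq f that by metis
  have "inj_on f (mspace m)"
  proof (rule inj_onI)
    fix x x' assume x: "x \<in> mspace m" "x' \<in> mspace m" "f x = f x'"
    have "mdist m' (f x') (f x') = 0" using f[OF x(2)] by (simp add: R_def)
    then have "mdist m x x' = 0" using d[OF x(1,2)] x(3) by simp
    with x show "x = x'" by simp
  qed
  moreover have "f ` mspace m = mspace m'"
  proof
    show "f ` mspace m \<subseteq> mspace m'" using f by (auto simp: R_def)
    show "mspace m' \<subseteq> f ` mspace m"
    proof
      fix y assume y: "y \<in> mspace m'"
      then obtain x where xy: "R x y" using ex' by blast
      then have x: "x \<in> mspace m" by (simp add: R_def)
      have "mdist m' y (f x) = mdist m x x" using eq[OF xy f[OF x]] by simp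
      then have "y = f x" using f[OF x] x y mdist_zero[of y m' "f x"] by (simp add: R_def)
      with x show "y \<in> f ` mspace m" by blast
    qed
  qed
  ultimately have "isometry m m' f" using d by (auto simp: isometry_def bij_betw_def)
  then show ?thesis by (auto simp: isometric_def)
qed

text \<open>Back-and-forth along enumerations of two countable dense sets.\<close>

lemma generic_unique:
  assumes g: "generic S m" "generic S m'" and c: "mcomplete_of m" "mcomplete_of m'"
    and sep: "countably_dense m" "countably_dense m'" and ne: "mspace m \<noteq> {}" "mspace m' \<noteq> {}"
  shows "isometric m m'"
proof -
  obtain D where D: "D \<subseteq> mspace m" "countable D"
    "\<And>x e. x \<in> mspace m \<Longrightarrow> e > 0 \<Longrightarrow> \<exists>a\<in>D. mdist m x a < e"
    using sep(1) by (auto simp: countably_dense_def)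
  obtain D' where D': "D' \<subseteq> mspace m'" "countable D'"
    "\<And>x e. x \<in> mspace m' \<Longrightarrow> e > 0 \<Longrightarrow> \<exists>a\<in>D'. mdist m' x a < e"
    using sep(2) by (auto simp: countably_dense_def)
  have Dne: "D \<noteq> {}" "D' \<noteq> {}" using D(3)[OF _ zero_less_one] D'(3)[OF _ zero_less_one] ne by blast+
  let ?e = "from_nat_into D" and ?e' = "from_nat_into D'"
  have eM: "?e n \<in> mspace m" "?e' n \<in> mspace m'" for n
    using from_nat_into[OF Dne(1)] from_nat_into[OF Dne(2)] D(1) D'(1) by blast+
  obtain G where G: "\<And>n. finite (G n) \<and> partial_isometry m m' (G n)"
    and step: "\<And>n. G n \<subseteq> G (Suc n) \<and> ?e n \<in> Domain (G (Suc n)) \<and> ?e' n \<in> Range (G (Suc n))"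
  proof -
    have "\<exists>G. \<forall>n. (finite (G n) \<and> partial_isometry m m' (G n)) \<and>
        (G n \<subseteq> G (Suc n) \<and> ?e n \<in> Domain (G (Suc n)) \<and> ?e' n \<in> Range (G (Suc n)))"
    proof (rule dependent_nat_choice
        [where P = "\<lambda>_ G. finite G \<and> partial_isometry m m' G" and
          Q = "\<lambda>n G G'. G \<subseteq> G' \<and> ?e n \<in> Domain G' \<and> ?e' n \<in> Range G'"])
      show "\<exists>G. finite G \<and> partial_isometry m m' G"
        by (rule exI[of _ "{}"]) (simp add: partial_isometry_def)
      fix G n assume G: "finite G \<and> partial_isometry m m' G"
      obtain y where y: "partial_isometry m m' (insert (?e n, y) G)"
        using partial_isometry_extend[OF g ne(2) _ _ eM(1)] G by metis
      let ?K = "insert (?e n, y) G"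
      obtain x where "partial_isometry m' m (insert (?e' n, x) (?K\<inverse>))"
        using partial_isometry_extend[OF g(2,1) ne(1) _ partial_isometry_converse[OF y] eM(2)] G
        by (metis finite_converse finite_insert)
      moreover have "(insert (?e' n, x) (?K\<inverse>))\<inverse> = insert (x, ?e' n) ?K"
        by auto
      ultimately have "partial_isometry m m' (insert (x, ?e' n) ?K)"
        using partial_isometry_converse by metis
      with G show "\<exists>G'. (finite G' \<and> partial_isometry m m' G') \<and>
          (G \<subseteq> G' \<and> ?e n \<in> Domain G' \<and> ?e' n \<in> Range G')"
        by (intro exI[of _ "insert (x, ?e' n) ?K"] conjI) auto
    qed
    then show thesis using that by blast
  qed
  have mono: "G i \<subseteq> G j" if "i \<le> j" for i j
    using lift_Suc_mono_le[of G] step that by blast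
  have pi: "partial_isometry m m' (\<Union>n. G n)"
    unfolding partial_isometry_def
  proof (intro conjI ballI)
    show "(\<Union>n. G n) \<subseteq> mspace m \<times> mspace m'" using G unfolding partial_isometry_def by blast
    have "mdist m x x' = mdist m' y y'"
      if xy: "(x, y) \<in> G i" and xy': "(x', y') \<in> G j" for x y x' y' i j
    proof -
      have "(x, y) \<in> G (max i j)" "(x', y') \<in> G (max i j)"
        using mono[of i "max i j"] mono[of j "max i j"] xy xy' by auto
      then show ?thesis
        using G[of "max i j"] unfolding partial_isometry_def by fast
    qed
    then show "case p of (x, y) \<Rightarrow> \<forall>(x', y')\<in>(\<Union>n. G n). mdist m x x' = mdist m' y y'"
      if "p \<in> (\<Union>n. G n)" for p
      using that by fast
  qed
  have dom: "\<exists>b. (a, b) \<in> (\<Union>n. G n)" if a: "a \<in> D" for a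
  proof -
    obtain n where "?e n = a" using from_nat_into_surj[OF D(2) a] by blast
    with step[of n] have "a \<in> Domain (G (Suc n))" by simp
    then show ?thesis by blast
  qed
  have ran: "\<exists>a. (a, b) \<in> (\<Union>n. G n)" if b: "b \<in> D'" for b
  proof -
    obtain n where "?e' n = b" using from_nat_into_surj[OF D'(2) b] by blast
    with step[of n] have "b \<in> Range (G (Suc n))" by simp
    then show ?thesis by blast
  qed
  show ?thesis
  proof (rule isometry_of_dense_partial_isometry[OF pi c])
    fix x and e :: real assume "x \<in> mspace m" "e > 0"
    with D(3) obtain a where "a \<in> D" "mdist m x a < e" by blast
    with dom[of a] show "\<exists>(a, b)\<in>(\<Union>n. G n). mdist m x a < e" by fast
  next
    fix y and e :: real assume "y \<in> mspace m'" "e > 0"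
    with D'(3) obtain b where "b \<in> D'" "mdist m' y b < e" by blast
    with ran[of b] show "\<exists>(a, b)\<in>(\<Union>n. G n). mdist m' y b < e" by fast
  qed
qed

section \<open>One of two colours contains a branching set\<close>

text \<open>The ball contains a set of colour \<open>P\<close> that branches at all radii below its own radius. Here and below,
\<open>P\<close> is one colour class (red) of a set \<open>Z\<close>, and \<open>Z - P\<close> is the other (blue).\<close>

definition rich :: "'a metric \<Rightarrow> real set \<Rightarrow> 'a set \<Rightarrow> 'a \<Rightarrow> real \<Rightarrow> bool" where
  "rich m T P x s \<longleftrightarrow> (\<exists>Y. Y \<noteq> {} \<and> Y \<subseteq> P \<and> (\<forall>y\<in>Y. mdist m x y < s) \<and>
     branching m {t \<in> T. t < s} Y)"

text \<open>All but finitely many of the pieces into which the closed ball of radius \<open>t\<close> around \<open>b\<close> splits are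
rich. A piece is named by any of its points in \<open>Z\<close>; the finitely many exceptions are those that meet
\<open>insert b A\<close>.\<close>

definition cofinitely_rich :: "'a metric \<Rightarrow> real set \<Rightarrow> 'a set \<Rightarrow> 'a set \<Rightarrow> 'a \<Rightarrow> real \<Rightarrow> bool" where
  "cofinitely_rich m T Z P b t \<longleftrightarrow> (\<exists>A. finite A \<and> A \<subseteq> mspace m \<and> (\<forall>a\<in>A. mdist m b a \<le> t) \<and>
     (\<forall>z\<in>Z. (\<forall>a\<in>insert b A. mdist m z a = t) \<longrightarrow> rich m T P z t))"

lemma cofinitely_rich_same_ball:
  assumes u: "ultrametric m" and b: "b \<in> mspace m" "b' \<in> mspace m" "mdist m b b' \<le> t"
    and r: "cofinitely_rich m T Z P b t"
  shows "cofinitely_rich m T Z P b' t"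
proof -
  obtain A where A: "finite A" "A \<subseteq> mspace m" "\<And>a. a \<in> A \<Longrightarrow> mdist m b a \<le> t"
    and rich: "\<And>z. z \<in> Z \<Longrightarrow> \<forall>a\<in>insert b A. mdist m z a = t \<Longrightarrow> rich m T P z t"
    using r unfolding cofinitely_rich_def by blast
  have "mdist m b' a \<le> t" if "a \<in> insert b A" for a
  proof (cases "a = b")
    case False
    with that have a: "a \<in> A" by simp
    have "mdist m b' b \<le> t" using b(3) by (simp add: mdist_commute)
    then show ?thesis using ultra_le[OF u b(2,1)] A(3)[OF a] A(2) a by blast
  qed (use b in \<open>simp add: mdist_commute\<close>)
  moreover have "rich m T P z t" if "z \<in> Z" "\<forall>a\<in>insert b' (insert b A). mdist m z a = t" for z
    using rich that by blast
  moreover have "finite (insert b A)" "insert b A \<subseteq> mspace m" using A b by auto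
  ultimately show ?thesis
    unfolding cofinitely_rich_def by blast
qed

text \<open>Every blue point \<open>b\<close> has a largest radius \<open>\<tau> b\<close> for which the closed ball around it is cofinitely rich.
Two such balls that meet coincide, by maximality. In each of them the points of \<open>Z\<close> are replaced by all
red branching subsets of its pieces. What results is red, and it still branches: below \<open>\<tau> b\<close> because the
inserted sets do, at \<open>\<tau> b\<close> because infinitely many pieces are rich, and above because \<open>Z\<close>
branches and no replaced ball has become empty.\<close>

lemma rich_by_replacement:
  assumes u: "ultrametric m" and T: "T \<subseteq> {0<..}" "reverse_well_ordered T"
    and Z: "Z \<subseteq> mspace m" "branching m T Z" and P: "P \<subseteq> Z" and x: "x \<in> Z" "s > 0"
    and bad: "\<And>b. b \<in> Z - P \<Longrightarrow> mdist m x b < s \<Longrightarrow> \<exists>t\<in>T. t < s \<and> cofinitely_rich m T Z P b t"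
  shows "rich m T P x s"
proof -
  define B where "B = {b \<in> Z - P. mdist m x b < s}"
  have BM: "b \<in> mspace m" "b \<in> Z" if "b \<in> B" for b using that Z by (auto simp: B_def)
  have xM: "x \<in> mspace m" using x Z by blast
  have "\<exists>t. t \<in> T \<and> t < s \<and> cofinitely_rich m T Z P b t \<and>
      (\<forall>t'\<in>T. t' < s \<and> cofinitely_rich m T Z P b t' \<longrightarrow> t' \<le> t)" if b: "b \<in> B" for b
  proof -
    let ?C = "{t \<in> T. t < s \<and> cofinitely_rich m T Z P b t}"
    have "?C \<subseteq> T" "?C \<noteq> {}" using bad[of b] b by (auto simp: B_def)
    from T(2)[unfolded reverse_well_ordered_def, rule_format, OF this]
    show ?thesis by blast
  qed
  then obtain \<tau> where "\<forall>b\<in>B. \<tau> b \<in> T \<and> \<tau> b < s \<and> cofinitely_rich m T Z P b (\<tau> b) \<and>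
      (\<forall>t'\<in>T. t' < s \<and> cofinitely_rich m T Z P b t' \<longrightarrow> t' \<le> \<tau> b)"
    using bchoice[of B] by (metis (no_types, lifting))
  then have \<tau>: "\<And>b. b \<in> B \<Longrightarrow> \<tau> b \<in> T" "\<And>b. b \<in> B \<Longrightarrow> \<tau> b < s"
    "\<And>b. b \<in> B \<Longrightarrow> cofinitely_rich m T Z P b (\<tau> b)"
    and max: "\<And>b t. b \<in> B \<Longrightarrow> t \<in> T \<Longrightarrow> t < s \<Longrightarrow> cofinitely_rich m T Z P b t \<Longrightarrow> t \<le> \<tau> b"
    by simp_all
  have \<tau>pos: "\<tau> b > 0" if "b \<in> B" for b using \<tau>(1)[OF that] T by auto
  have le1: "\<tau> b \<le> \<tau> b'" if "b \<in> B" "b' \<in> B" "mdist m b b' \<le> \<tau> b" for b b'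
    using max[OF that(2) \<tau>(1,2)[OF that(1)]]
      cofinitely_rich_same_ball[OF u BM(1)[OF that(1)] BM(1)[OF that(2)] that(3) \<tau>(3)[OF that(1)]]
    by blast
  \<comment> \<open>Balls of radius \<open>\<tau>\<close> around blue points that share a point have equal radii, hence coincide.\<close>
  have disj: "\<tau> b = \<tau> b'"
    if b: "b \<in> B" "b' \<in> B" and p: "p \<in> mspace m" "mdist m p b \<le> \<tau> b" "mdist m p b' \<le> \<tau> b'" for b b' p
  proof -
    have "mdist m b b' \<le> max (\<tau> b) (\<tau> b')"
      using ultra_le[OF u BM(1)[OF b(1)] p(1) BM(1)[OF b(2)]] p by (simp add: mdist_commute)
    then show ?thesis
      using le1[OF b] le1[OF b(2,1)] by (auto simp: max_def mdist_commute split: if_splits)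
  qed
  \<comment> \<open>\<open>D\<close> is the region to be replaced, \<open>W b\<close> what is put into the ball around \<open>b\<close>.
    Taking all red branching sets at once avoids choosing one for each piece.\<close>
  define D where "D = {p \<in> mspace m. \<exists>b\<in>B. mdist m p b \<le> \<tau> b}"
  define W where "W b = \<Union>{W. W \<subseteq> P \<and> branching m {t \<in> T. t < \<tau> b} W \<and>
      (\<exists>z\<in>Z. mdist m z b \<le> \<tau> b \<and> (\<forall>w\<in>W. mdist m z w < \<tau> b))}" for b
  define Y where "Y = {z \<in> Z. mdist m x z < s \<and> z \<notin> D} \<union> (\<Union>b\<in>B. W b)"
  have Wb: "w \<in> P" "mdist m w b \<le> \<tau> b" if "b \<in> B" "w \<in> W b" for w b
  proof -
    obtain z where z: "w \<in> P" "z \<in> Z" "mdist m z b \<le> \<tau> b" "mdist m z w < \<tau> b"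
      using \<open>w \<in> W b\<close> unfolding W_def by blast
    show "w \<in> P" by fact
    show "mdist m w b \<le> \<tau> b"
      using ultra_le[OF u, of w z b "\<tau> b"] z Z P BM(1)[OF \<open>b \<in> B\<close>] by (auto simp: mdist_commute)
  qed
  have inball: "mdist m x p < s" if "b \<in> B" "p \<in> mspace m" "mdist m p b \<le> \<tau> b" for b p
    using ultra_less[OF u xM BM(1)[OF that(1)] that(2), of s] that \<tau>(2)[OF that(1)]
    by (simp add: B_def mdist_commute)
  have YP: "Y \<subseteq> P"
  proof
    fix y assume "y \<in> Y"
    then consider "y \<in> Z" "mdist m x y < s" "y \<notin> D" | b where "b \<in> B" "y \<in> W b"
      unfolding Y_def by blast
    then show "y \<in> P"
    proof cases
      case 1
      have "mdist m y y \<le> \<tau> y" if "y \<in> B"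
        using \<tau>pos[OF that] mdist_self[OF BM(1)[OF that]] by simp
      with 1 BM have "y \<notin> B" unfolding D_def by blast
      with 1 show ?thesis by (simp add: B_def)
    qed (use Wb in auto)
  qed
  then have YM: "y \<in> mspace m" "y \<in> Z" if "y \<in> Y" for y using that P Z by auto
  have Yball: "mdist m x y < s" if "y \<in> Y" for y
    using that inball Wb YM(1)[OF that] unfolding Y_def by blast
  \<comment> \<open>A replaced ball has points of \<open>Y\<close> in infinitely many of its pieces, since \<open>Z\<close> meets infinitely
    many pieces and all but finitely many of these are rich.\<close>
  have refill: "\<exists>w\<in>Y. \<forall>a\<in>insert b A. mdist m w a = \<tau> b"
    if b: "b \<in> B" and A: "finite A" "A \<subseteq> mspace m" "\<And>a. a \<in> A \<Longrightarrow> mdist m b a \<le> \<tau> b" for b A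
  proof -
    obtain A0 where A0: "finite A0" "A0 \<subseteq> mspace m" "\<And>a. a \<in> A0 \<Longrightarrow> mdist m b a \<le> \<tau> b"
      and rich: "\<And>z. z \<in> Z \<Longrightarrow> \<forall>a\<in>insert b A0. mdist m z a = \<tau> b \<Longrightarrow> rich m T P z (\<tau> b)"
      using \<tau>(3)[OF b] unfolding cofinitely_rich_def by blast
    obtain z where z: "z \<in> Z" "mdist m z b = \<tau> b" "\<And>a. a \<in> A \<union> A0 \<Longrightarrow> mdist m z a = \<tau> b"
      using branchingD[OF Z(2) BM(2)[OF b] \<tau>(1)[OF b], of "A \<union> A0"] A A0 by blast
    then obtain V where V: "V \<noteq> {}" "V \<subseteq> P" "\<And>w. w \<in> V \<Longrightarrow> mdist m z w < \<tau> b"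
      "branching m {t \<in> T. t < \<tau> b} V"
      using rich[of z] unfolding rich_def by auto
    then obtain w where w: "w \<in> V" by blast
    have "V \<subseteq> W b"
      unfolding W_def using V(2-4) z(1,2)
      by (intro Union_upper CollectI conjI bexI[of _ z]) auto
    with w b have wY: "w \<in> Y" unfolding Y_def by blast
    have zM: "z \<in> mspace m" using z Z by blast
    have "mdist m w a = \<tau> b" if "a \<in> insert b A" for a
      using ultra_isosceles[OF u YM(1)[OF wY] zM, of a "\<tau> b"] V(3)[OF w] z that A(2) BM(1)[OF b]
      by (auto simp: mdist_commute)
    with wY show ?thesis by blast
  qed
  have "Y \<noteq> {}"
  proof (cases "x \<in> D")
    case True
    then obtain b where "b \<in> B" by (auto simp: D_def)
    from refill[OF this, of "{}"] show ?thesis by auto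
  next
    case False
    with x xM have "x \<in> Y" by (simp add: Y_def mdist_self)
    then show ?thesis by blast
  qed
  moreover have "branching m {t \<in> T. t < s} Y"
    unfolding branching_def
  proof (intro ballI allI impI)
    fix y t A assume y: "y \<in> Y" and t: "t \<in> {t \<in> T. t < s}"
      and A: "finite A" "A \<subseteq> mspace m" "\<forall>a\<in>A. mdist m y a \<le> t"
    show "\<exists>z\<in>Y. \<forall>a\<in>insert y A. mdist m z a = t"
    \<comment> \<open>Does the closed ball of radius \<open>t\<close> around \<open>y\<close> lie inside a replaced ball?\<close>
    proof (cases "\<exists>b\<in>B. mdist m y b \<le> \<tau> b \<and> t \<le> \<tau> b")
      case True
      then obtain b0 where b0: "b0 \<in> B" "mdist m y b0 \<le> \<tau> b0" "t \<le> \<tau> b0" by blast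
      then have "y \<in> D" using YM(1)[OF y] by (auto simp: D_def)
      then obtain b where b: "b \<in> B" "y \<in> W b" using y by (auto simp: Y_def)
      have yb: "mdist m y b \<le> \<tau> b" using Wb b by blast
      have eq: "\<tau> b0 = \<tau> b" using disj[OF b0(1) b(1) YM(1)[OF y] b0(2) yb] .
      show ?thesis
      proof (cases "t = \<tau> b")
        case True
        have "mdist m b a \<le> \<tau> b" if "a \<in> insert y A" for a
          using ultra_le[OF u BM(1)[OF b(1)] YM(1)[OF y], of a "\<tau> b"] that A True yb YM(1)[OF y]
          by (auto simp: mdist_commute mdist_self)
        then show ?thesis
          using refill[OF b(1), of "insert y A"] A YM(1)[OF y] True by auto
      next
        case False
        then have tb: "t \<in> {t \<in> T. t < \<tau> b}" using b0 eq t by auto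
        obtain V z where V: "y \<in> V" "V \<subseteq> P" "branching m {t \<in> T. t < \<tau> b} V"
          "z\<in>Z" "mdist m z b \<le> \<tau> b" "\<forall>w\<in>V. mdist m z w < \<tau> b"
          using b(2) unfolding W_def by blast
        then have "V \<subseteq> W b"
          unfolding W_def by (intro Union_upper CollectI conjI bexI[of _ z]) auto
        then have "V \<subseteq> Y" using b(1) unfolding Y_def by blast
        moreover obtain w where "w \<in> V" "mdist m w y = t" "\<And>a. a \<in> A \<Longrightarrow> mdist m w a = t"
          using branchingD[OF V(3,1) tb A(1,2)] A(3) by blast
        ultimately show ?thesis by blast
      qed
    next
      case False
      have tT: "t \<in> T" "t < s" using t by auto
      obtain z where z: "z \<in> Z" "mdist m z y = t" "\<And>a. a \<in> A \<Longrightarrow> mdist m z a = t"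
        using branchingD[OF Z(2) YM(2)[OF y] tT(1) A(1,2)] A(3) by blast
      have zM: "z \<in> mspace m" using z Z by blast
      have xz: "mdist m x z < s"
        using ultra_less[OF u xM YM(1)[OF y] zM] Yball[OF y] z(2) tT by (simp add: mdist_commute)
      show ?thesis
      proof (cases "z \<in> D")
        case False
        with z xz have "z \<in> Y" by (simp add: Y_def)
        with z show ?thesis by blast
      next
        case True
        then obtain b where b: "b \<in> B" "mdist m z b \<le> \<tau> b" by (auto simp: D_def)
        \<comment> \<open>The replaced ball containing \<open>z\<close> lies within the piece of \<open>z\<close>, so any point of \<open>Y\<close> in it can
          serve instead of \<open>z\<close>.\<close>
        have "\<tau> b < t"
        proof (rule ccontr)
          assume "\<not> \<tau> b < t"
          then have "mdist m y b \<le> \<tau> b"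
            using ultra_le[OF u YM(1)[OF y] zM BM(1)[OF b(1)]] z(2) b(2) by (simp add: mdist_commute)
          with False b \<open>\<not> \<tau> b < t\<close> show False by auto
        qed
        obtain w where w: "w \<in> Y" "mdist m w b = \<tau> b" using refill[OF b(1), of "{}"] by auto
        have "mdist m w z < t"
          using ultra_le[OF u YM(1)[OF w(1)] BM(1)[OF b(1)] zM, of "\<tau> b"] w b \<open>\<tau> b < t\<close>
          by (simp add: mdist_commute)
        then have "mdist m w a = t" if "a \<in> insert y A" for a
          using ultra_isosceles[OF u YM(1)[OF w(1)] zM, of a t] that z A(2) YM(1)[OF y] by auto
        with w show ?thesis by blast
      qed
    qed
  qed
  ultimately show ?thesis
    unfolding rich_def using YP Yball by blast
qed

text \<open>The points considered are the blue ones with no cofinitely rich ball. By the preceding lemma each piece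
that is not rich contains a blue point whose balls of smaller radius are not cofinitely rich; if the
piece itself lies in the ball of such a point, the balls of larger radius are not
cofinitely rich either, being balls around that point.\<close>

lemma branching_dichotomy:
  assumes u: "ultrametric m" and T: "T \<subseteq> {0<..}" "reverse_well_ordered T"
    and Z: "Z \<subseteq> mspace m" "branching m T Z" "Z \<noteq> {}" and P: "P \<subseteq> Z"
  shows "\<exists>Y. Y \<noteq> {} \<and> branching m T Y \<and> (Y \<subseteq> P \<or> Y \<subseteq> Z - P)"
proof -
  \<comment> \<open>The whole set is treated as a ball whose radius exceeds all elements of \<open>T\<close>.\<close>
  obtain s0 where s0: "s0 > 0" "\<And>t. t \<in> T \<Longrightarrow> t < s0"
  proof (cases "T = {}")
    case True
    then show thesis using that[of 1] by simp
  next
    case False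
    then obtain t0 where "t0 \<in> T" "\<And>t. t \<in> T \<Longrightarrow> t \<le> t0"
      using T(2)[unfolded reverse_well_ordered_def, rule_format, OF subset_refl] by blast
    then have "t0 + 1 > 0" "t < t0 + 1" if "t \<in> T" for t
      using T(1) that by force+
    with \<open>t0 \<in> T\<close> show thesis by (intro that[of "t0 + 1"])
  qed
  obtain x0 where x0: "x0 \<in> Z" using Z by blast
  show ?thesis
  proof (cases "rich m T P x0 s0")
    case True
    moreover have "{t \<in> T. t < s0} = T" using s0 by auto
    ultimately show ?thesis unfolding rich_def by auto
  next
    case False
    have blue: "\<exists>b\<in>Z - P. mdist m x b < s \<and> (\<forall>t\<in>T. t < s \<longrightarrow> \<not> cofinitely_rich m T Z P b t)"
      if "x \<in> Z" "s > 0" "\<not> rich m T P x s" for x s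
      using rich_by_replacement[OF u T Z(1,2) P that(1,2)] that(3) by blast
    define Y where "Y = {b \<in> Z - P. \<forall>t\<in>T. \<not> cofinitely_rich m T Z P b t}"
    have "Y \<noteq> {}" using blue[OF x0 s0(1) False] s0(2) unfolding Y_def by blast
    moreover have "branching m T Y"
      unfolding branching_def
    proof (intro ballI allI impI)
      fix y t A assume y: "y \<in> Y" and t: "t \<in> T"
        and A: "finite A" "A \<subseteq> mspace m" "\<forall>a\<in>A. mdist m y a \<le> t"
      have yM: "y \<in> mspace m" using y Z by (auto simp: Y_def)
      have "\<not> cofinitely_rich m T Z P y t" using y t by (simp add: Y_def)
      then obtain z where z: "z \<in> Z" "\<forall>a\<in>insert y A. mdist m z a = t" "\<not> rich m T P z t"
        unfolding cofinitely_rich_def using A by metis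
      obtain b where b: "b \<in> Z - P" "mdist m z b < t"
        and b': "\<And>r. r \<in> T \<Longrightarrow> r < t \<Longrightarrow> \<not> cofinitely_rich m T Z P b r"
        using blue[OF z(1) _ z(3)] t T(1) by blast
      have zM: "z \<in> mspace m" and bM: "b \<in> mspace m" using z b Z by auto
      have ba: "mdist m b a = t" if "a \<in> insert y A" for a
        using ultra_isosceles[OF u bM zM, of a t] that z(2) b(2) A(2) yM by (auto simp: mdist_commute)
      have "\<not> cofinitely_rich m T Z P b r" if r: "r \<in> T" for r
      \<comment> \<open>For \<open>r \<ge> t\<close> the closed balls of radius \<open>r\<close> around \<open>b\<close> and around \<open>y\<close> coincide.\<close>
      proof (cases "r < t")
        case False
        then have "mdist m b y \<le> r" using ba[of y] by simp
        then have "cofinitely_rich m T Z P b r \<Longrightarrow> cofinitely_rich m T Z P y r"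
          using cofinitely_rich_same_ball[OF u bM yM] by blast
        with y r show ?thesis by (auto simp: Y_def)
      qed (use b' r in blast)
      with b have "b \<in> Y" by (simp add: Y_def)
      with ba show "\<exists>z\<in>Y. \<forall>a\<in>insert y A. mdist m z a = t" by blast
    qed
    moreover have "Y \<subseteq> Z - P" by (auto simp: Y_def)
    ultimately show ?thesis by blast
  qed
qed

lemma branching_pigeonhole:
  fixes c :: "'a \<Rightarrow> nat"
  assumes u: "ultrametric m" and T: "T \<subseteq> {0<..}" "reverse_well_ordered T"
    and Z: "Z \<subseteq> mspace m" "branching m T Z" "Z \<noteq> {}" and c: "c \<in> Z \<rightarrow> {..<k}"
  shows "\<exists>i<k. \<exists>Y. Y \<noteq> {} \<and> branching m T Y \<and> Y \<subseteq> {z \<in> Z. c z = i}"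
  using Z c
proof (induction k arbitrary: Z)
  case 0
  then obtain z where "z \<in> Z" by blast
  with 0 have "c z \<in> {..<0}" by blast
  then show ?case by simp
next
  case (Suc k)
  let ?P = "{z \<in> Z. c z = k}"
  obtain Y where Y: "Y \<noteq> {}" "branching m T Y" "Y \<subseteq> ?P \<or> Y \<subseteq> Z - ?P"
    using branching_dichotomy[OF u T Suc.prems(1-3) Collect_restrict] by metis
  from Y(3) show ?case
  proof
    assume "Y \<subseteq> ?P"
    with Y show ?thesis by blast
  next
    assume Y': "Y \<subseteq> Z - ?P"
    then have "c \<in> Y \<rightarrow> {..<k}" using Suc.prems(4) by (auto simp: Pi_iff less_Suc_eq)
    moreover have "Y \<subseteq> mspace m" using Y' Suc.prems(1) by blast
    ultimately obtain i V where "i < k" "V \<noteq> {}" "branching m T V" "V \<subseteq> {z \<in> Y. c z = i}"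
      using Suc.IH[of Y] Y(1,2) by blast
    moreover have "{z \<in> Y. c z = i} \<subseteq> {z \<in> Z. c z = i}" using Y' by blast
    ultimately show ?thesis by (meson less_Suc_eq order_trans)
  qed
qed

section \<open>Transfer to isometric copies and completions\<close>

lemma generic_isometric:
  assumes "isometric m m'" and g: "generic S m'"
  shows "generic S m"
proof -
  obtain f where f: "bij_betw f (mspace m) (mspace m')"
    and d: "\<And>x y. x \<in> mspace m \<Longrightarrow> y \<in> mspace m \<Longrightarrow> mdist m' (f x) (f y) = mdist m x y"
    using assms(1) unfolding isometric_def isometry_def by blast
  have fM: "f x \<in> mspace m'" if "x \<in> mspace m" for x using f that bij_betwE by blast
  show ?thesis
    unfolding generic_def
  proof (intro conjI ballI impI)
    have u: "ultrametric m'" using g by (simp add: generic_def)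
    show "ultrametric m"
      unfolding ultrametric_def
    proof (intro ballI)
      fix x y z assume "x \<in> mspace m" "y \<in> mspace m" "z \<in> mspace m"
      then show "mdist m x z \<le> max (mdist m x y) (mdist m y z)"
        using u fM d unfolding ultrametric_def by metis
    qed
    show "branching m S (mspace m)"
      unfolding branching_def
    proof (intro ballI allI impI)
      fix y s A assume y: "y \<in> mspace m" and s: "s \<in> S"
        and A: "finite A" "A \<subseteq> mspace m" "\<forall>a\<in>A. mdist m y a \<le> s"
      have "\<exists>z\<in>mspace m'. \<forall>a\<in>insert (f y) (f ` A). mdist m' z a = s"
      proof -
        have "f y \<in> mspace m'" "finite (f ` A)" "f ` A \<subseteq> mspace m'"
          "\<forall>a\<in>f ` A. mdist m' (f y) a \<le> s"
          using y A fM d by auto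
        then show ?thesis using g s by (intro branching_ex[of m' S]) (auto simp: generic_def)
      qed
      then obtain z where z: "z \<in> mspace m'" "\<forall>a\<in>insert y A. mdist m' z (f a) = s" by auto
      then obtain w where w: "w \<in> mspace m" "z = f w" using f by (auto simp: bij_betw_def)
      have "mdist m w a = s" if "a \<in> insert y A" for a
      proof -
        have "a \<in> mspace m" using that A y by auto
        then show ?thesis using z(2) that d[OF w(1)] w(2) by fastforce
      qed
      with w show "\<exists>z\<in>mspace m. \<forall>a\<in>insert y A. mdist m z a = s" by blast
    qed
    fix x y assume xy: "x \<in> mspace m" "y \<in> mspace m" "x \<noteq> y"
    then have "f x \<noteq> f y" using f by (auto simp: bij_betw_def inj_on_def)
    then have "mdist m' (f x) (f y) \<in> S" using g xy fM by (simp add: generic_def)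
    then show "mdist m x y \<in> S" using d xy by simp
  qed
qed

lemma countably_dense_if_separable:
  assumes "separable_space (mtopology_of m)"
  shows "countably_dense m"
proof -
  interpret Metric_space "mspace m" "mdist m" by (rule Metric_space_mspace_mdist)
  obtain D where D: "countable D" "D \<subseteq> mspace m" "mtopology closure_of D = mspace m"
    using assms unfolding separable_space_def mtopology_of_def by auto
  have "\<exists>a\<in>D. mdist m x a < e" if x: "x \<in> mspace m" and e: "e > 0" for x e
  proof -
    have "\<exists>a\<in>D. a \<in> mball x e" using x e D(3) unfolding metric_closure_of by blast
    then show ?thesis by auto
  qed
  with D show ?thesis unfolding countably_dense_def by blast
qed

lemma completion_embed_approx:
  assumes "a \<in> completion_carrier m" "e > 0"
  shows "\<exists>x\<in>mspace m. completion_dist m a (completion_embed m x) < e"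
proof -
  obtain x where "x \<in> mspace m" "completion_dist m (completion_embed m x) a < e"
    using completion_embed_dense[OF assms] .
  then show ?thesis
    by (metis Metric_space.commute Metric_space_completion)
qed

lemma ultrametric_completion:
  assumes u: "ultrametric m"
  shows "ultrametric (metric_completion m)"
  unfolding ultrametric_def mspace_metric_completion mdist_metric_completion
proof (intro ballI)
  fix a b c assume "a \<in> completion_carrier m" "b \<in> completion_carrier m" "c \<in> completion_carrier m"
  then obtain x y z where xyz: "x \<in> mcauchy m" "a = mcauchy_rel m `` {x}"
    "y \<in> mcauchy m" "b = mcauchy_rel m `` {y}" "z \<in> mcauchy m" "c = mcauchy_rel m `` {z}"
    by (meson mcauchy_class_cases)
  have "mdist m (x n) (z n) \<le> max (mdist m (x n) (y n)) (mdist m (y n) (z n))" for n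
    using u xyz mcauchy_mspace unfolding ultrametric_def by metis
  then show "completion_dist m a c \<le> max (completion_dist m a b) (completion_dist m b c)"
    unfolding xyz(2,4,6)
    by (intro LIMSEQ_le[OF completion_dist_class[OF xyz(1,5)]
        tendsto_max[OF completion_dist_class[OF xyz(1,3)] completion_dist_class[OF xyz(3,5)]]]) auto
qed

text \<open>In an ultrametric space, moving a point by less than its distance to another point does not change that
distance. So the completion has no new distances, and a finite set can be moved into the original space,
where branching applies.\<close>

lemma generic_completion:
  assumes g: "generic S m" and S: "S \<subseteq> {0<..}"
  shows "generic S (metric_completion m)"
proof -
  let ?C = "metric_completion m" and ?i = "completion_embed m"
  have u: "ultrametric m" and u': "ultrametric ?C"
    using g ultrametric_completion by (auto simp: generic_def)
  have iM: "?i x \<in> mspace ?C" if "x \<in> mspace m" for x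
    using completion_embed_in[OF that] by simp
  have id: "mdist ?C (?i x) (?i y) = mdist m x y" if "x \<in> mspace m" "y \<in> mspace m" for x y
    using completion_embed_dist[OF that] by simp
  have dense: "\<exists>x\<in>mspace m. mdist ?C a (?i x) < e" if "a \<in> mspace ?C" "e > 0" for a e
    using completion_embed_approx[of a m e] that by simp
  note mspace_metric_completion [simp del] mdist_metric_completion [simp del]
  show ?thesis
    unfolding generic_def
  proof (intro conjI ballI impI)
    show "ultrametric ?C" by (rule u')
    show "branching ?C S (mspace ?C)"
      unfolding branching_def
    proof (intro ballI allI impI)
      fix y s A assume y: "y \<in> mspace ?C" and s: "s \<in> S"
        and A: "finite A" "A \<subseteq> mspace ?C" "\<forall>a\<in>A. mdist ?C y a \<le> s"
      have s0: "s > 0" using s S by auto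
      have AM: "a \<in> mspace ?C" if "a \<in> insert y A" for a using that y A by blast
      have ya: "mdist ?C y a \<le> s" if "a \<in> insert y A" for a
        using that A(3) s0 mdist_self[OF y] by auto
      \<comment> \<open>The error \<open>s\<close> of the approximation does not affect distances equal to \<open>s\<close>.\<close>
      have "\<forall>a\<in>insert y A. \<exists>x. x \<in> mspace m \<and> mdist ?C a (?i x) < s"
        using dense[OF AM s0] by blast
      then obtain p where p: "\<And>a. a \<in> insert y A \<Longrightarrow> p a \<in> mspace m"
        "\<And>a. a \<in> insert y A \<Longrightarrow> mdist ?C a (?i (p a)) < s"
        using bchoice[of "insert y A"] by metis
      have "mdist m (p y) (p a) \<le> s" if a: "a \<in> insert y A" for a
      proof -
        have y': "y \<in> insert y A" by simp
        have "mdist ?C (?i (p y)) a \<le> s"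
          using ultra_le[OF u' iM[OF p(1)[OF y']] y AM[OF a]] p(2)[OF y'] ya[OF a]
          by (simp add: mdist_commute less_imp_le)
        then have "mdist ?C (?i (p y)) (?i (p a)) \<le> s"
          using ultra_le[OF u' iM[OF p(1)[OF y']] AM[OF a] iM[OF p(1)[OF a]]] p(2)[OF a]
          by (simp add: less_imp_le)
        then show ?thesis using id[OF p(1)[OF y'] p(1)[OF a]] by simp
      qed
      then have "\<exists>z\<in>mspace m. \<forall>b\<in>insert (p y) (p ` A). mdist m z b = s"
        using g s p(1) A(1) by (intro branching_ex[of m S]) (auto simp: generic_def)
      then obtain z where z: "z \<in> mspace m" "\<And>a. a \<in> insert y A \<Longrightarrow> mdist m z (p a) = s" by auto
      have "mdist ?C (?i z) a = s" if a: "a \<in> insert y A" for a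
        using ultra_isosceles[OF u' AM[OF a] iM[OF p(1)[OF a]] iM[OF z(1)], of s]
          p(2)[OF a] id[OF z(1) p(1)[OF a]] z(2)[OF a] by (simp add: mdist_commute)
      then show "\<exists>z\<in>mspace ?C. \<forall>a\<in>insert y A. mdist ?C z a = s" using iM[OF z(1)] by blast
    qed
    fix a b assume ab: "a \<in> mspace ?C" "b \<in> mspace ?C" "a \<noteq> b"
    define r where "r = mdist ?C a b"
    have r: "r > 0" using ab mdist_nonneg[of ?C a b] by (simp add: r_def less_le)
    obtain x where x: "x \<in> mspace m" "mdist ?C a (?i x) < r" using dense[OF ab(1) r] by blast
    obtain y where y: "y \<in> mspace m" "mdist ?C b (?i y) < r" using dense[OF ab(2) r] by blast
    have "mdist ?C (?i x) a < r" "mdist ?C (?i y) b < r"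
      using x(2) y(2) mdist_commute by metis+
    note near = this
    have "mdist ?C (?i x) b = r"
      using ultra_isosceles[OF u' iM[OF x(1)] ab(1,2) near(1)] r_def by blast
    then have "mdist ?C b (?i x) = r" using mdist_commute by metis
    then have "mdist ?C (?i y) (?i x) = r"
      using ultra_isosceles[OF u' iM[OF y(1)] ab(2) iM[OF x(1)] near(2)] by blast
    then have yx: "mdist m y x = r" using id[OF y(1) x(1)] by simp
    then have "y \<noteq> x" using r mdist_self[OF x(1)] by auto
    then have "mdist m y x \<in> S" using g x(1) y(1) unfolding generic_def by blast
    with yx show "mdist ?C a b \<in> S" by (simp add: r_def)
  qed
qed

lemma countably_dense_completion:
  assumes "countable (mspace m)"
  shows "countably_dense (metric_completion m)"
  unfolding countably_dense_def
  using assms completion_embed_approx completion_embed_in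
  by (intro exI[of _ "completion_embed m ` mspace m"]) auto

text \<open>A finitely supported function is determined by the finite part of its graph above its support.\<close>

lemma countable_B_carrier:
  assumes "countable S"
  shows "countable (B_carrier S)"
proof (rule countable_image_inj_on)
  let ?G = "\<lambda>x :: real \<Rightarrow> rat. {(s, x s) | s. x s \<noteq> 0}"
  have "?G ` B_carrier S \<subseteq> {A. finite A \<and> A \<subseteq> S \<times> UNIV}"
  proof
    fix A assume "A \<in> ?G ` B_carrier S"
    then obtain x where x: "x \<in> B_carrier S" "A = ?G x" by blast
    have "A = (\<lambda>s. (s, x s)) ` {s. x s \<noteq> 0}" using x by auto
    with x show "A \<in> {A. finite A \<and> A \<subseteq> S \<times> UNIV}" by (auto simp: B_carrier_def)
  qed
  moreover have "countable {A :: (real \<times> rat) set. finite A \<and> A \<subseteq> S \<times> UNIV}"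
    using assms by (intro countable_Collect_finite_subset countable_SIGMA) auto
  ultimately show "countable (?G ` B_carrier S)" by (rule countable_subset)
  show "inj_on ?G (B_carrier S)"
  proof (rule inj_onI, rule ext)
    fix x y s assume "?G x = ?G y"
    then have "(s, r) \<in> ?G x \<longleftrightarrow> (s, r) \<in> ?G y" for r by simp
    then show "x s = y s" by auto metis
  qed
qed

text \<open>To be at distance \<open>s\<close> from finitely many points of a closed ball of radius \<open>s\<close>, it is enough to change the
value at \<open>s\<close> of the centre to one of the infinitely many rationals that none of them takes there.\<close>

lemma generic_B_space:
  assumes S: "S \<subseteq> {0<..}"
  shows "generic S (B_space S)"
  unfolding generic_def ultrametric_def branching_def mspace_B_space[OF S] mdist_B_space[OF S]
proof (intro conjI ballI allI impI)
  fix x s A assume x: "x \<in> B_carrier S" and s: "s \<in> S"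
    and A: "finite A" "A \<subseteq> B_carrier S" "\<forall>a\<in>A. B_dist S x a \<le> s"
  have xa: "B_dist S x a \<le> s" if "a \<in> insert x A" for a
    using that A(3) s S by (auto simp: B_dist_def)
  have "finite ((\<lambda>a. a s) ` insert x A)" using A by simp
  then obtain q :: rat where q: "q \<notin> (\<lambda>a. a s) ` insert x A"
    using ex_new_if_finite[OF infinite_UNIV_char_0] by blast
  define z where "z = x(s := q)"
  have z: "z \<in> B_carrier S"
  proof -
    have "{t. z t \<noteq> 0} \<subseteq> insert s {t. x t \<noteq> 0}" by (auto simp: z_def)
    then show ?thesis
      using x s finite_subset[of "{t. z t \<noteq> 0}"] by (auto simp: B_carrier_def)
  qed
  have "B_dist S z a = s" if a: "a \<in> insert x A" for a
  proof (rule antisym)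
    have aB: "a \<in> B_carrier S" using a A x by blast
    have zs: "z s \<noteq> a s" using q a by (auto simp: z_def)
    then have ne: "z \<noteq> a" by auto
    show "s \<le> B_dist S z a" using B_dist_Max(3)[OF z aB ne zs] .
    show "B_dist S z a \<le> s"
    proof (rule ccontr)
      assume "\<not> B_dist S z a \<le> s"
      then have "x (B_dist S z a) \<noteq> a (B_dist S z a)"
        using B_dist_Max(2)[OF z aB ne] by (simp add: z_def)
      moreover from this have "x \<noteq> a" by auto
      ultimately have "B_dist S z a \<le> B_dist S x a" using B_dist_Max(3)[OF x aB] by blast
      with xa[OF a] \<open>\<not> B_dist S z a \<le> s\<close> show False by simp
    qed
  qed
  with z show "\<exists>z\<in>B_carrier S. \<forall>a\<in>insert x A. B_dist S z a = s" by blast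
qed (use B_dist_ultra[OF S] B_dist_Max(1) in auto)

section \<open>Sufficiency of the reverse well-ordering\<close>

text \<open>A set that contains an \<open>e\<close>-neighbourhood of each of its points is closed, hence complete, and inherits a
countable dense set; so the uniqueness of generic spaces applies to it.\<close>

lemma isometric_submetric_of_branching:
  assumes g: "generic S m" and c: "mcomplete_of m" and sep: "countably_dense m"
    and Y: "Y \<subseteq> mspace m" "Y \<noteq> {}" "branching m S Y"
    and e: "e > 0" "\<And>y x. y \<in> Y \<Longrightarrow> x \<in> mspace m \<Longrightarrow> mdist m y x \<le> e \<Longrightarrow> x \<in> Y"
  shows "isometric (submetric m Y) m"
proof (rule generic_unique)
  have sp: "mspace (submetric m Y) = Y" and di: "mdist (submetric m Y) = mdist m"
    using Y(1) by (auto simp: mspace_submetric)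
  interpret Submetric "mspace m" "mdist m" Y
    using Y(1) by (simp add: Submetric_def Submetric_axioms_def)
  have "sub.mcomplete"
  proof (rule sequentially_closedin_mcomplete_imp_mcomplete)
    show "mcomplete" using c by (simp add: mcomplete_of_def)
    fix \<sigma> l assume \<sigma>: "range \<sigma> \<subseteq> Y \<and> limitin mtopology \<sigma> l sequentially"
    then have l: "l \<in> mspace m" "(\<lambda>n. mdist m (\<sigma> n) l) \<longlonglongrightarrow> 0" by (auto simp: limitin_metric_dist_null)
    obtain n where "mdist m (\<sigma> n) l < e"
      using order_tendstoD(2)[OF l(2) e(1)] by (auto simp: eventually_sequentially)
    with e(2)[of "\<sigma> n" l] \<sigma> l show "l \<in> Y" by auto
  qed
  then show "mcomplete_of (submetric m Y)" by (simp add: mcomplete_of_def Int_absorb2[OF Y(1)])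
  show "generic S (submetric m Y)"
    using g Y unfolding generic_def ultrametric_def branching_def sp di
    by (meson subsetD subset_trans)
  show "countably_dense (submetric m Y)"
  proof -
    obtain D where D: "D \<subseteq> mspace m" "countable D"
      "\<And>x r. x \<in> mspace m \<Longrightarrow> r > 0 \<Longrightarrow> \<exists>a\<in>D. mdist m x a < r"
      using sep unfolding countably_dense_def by metis
    have "\<exists>a\<in>D \<inter> Y. mdist m x a < r" if "x \<in> Y" "r > 0" for x r
    proof -
      have "x \<in> mspace m" "min r e > 0" using that Y e by auto
      then obtain a where "a \<in> D" "mdist m x a < min r e" using D(3) by blast
      with e(2)[of x a] D(1) that show ?thesis by auto
    qed
    with D(2) show ?thesis unfolding countably_dense_def sp di by (intro exI[of _ "D \<inter> Y"]) auto
  qed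
qed (use g c sep Y in \<open>auto simp: mspace_submetric\<close>)

text \<open>The pigeonhole lemma is applied to a set of representatives of the closed balls of radius \<open>e\<close>, coloured by
the given colouring, and to the distances above \<open>e\<close>. Thickening the resulting set by \<open>e\<close> restores the
branching at the smaller distances.\<close>

lemma approx_indivisible_if_reverse_well_ordered:
  assumes g: "generic S m" and S: "S \<subseteq> {0<..}" "reverse_well_ordered S"
    and c: "mcomplete_of m" and sep: "countably_dense m" and ne: "mspace m \<noteq> {}"
  shows "approx_indivisible m"
  unfolding approx_indivisible_def eps_indivisible_def
proof (intro allI impI ballI)
  fix e :: real and k :: nat and c :: "'a \<Rightarrow> nat"
  assume e: "e > 0" and c: "c \<in> mspace m \<rightarrow> {..<k}"
  have u: "ultrametric m" and br: "branching m S (mspace m)" using g by (auto simp: generic_def)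
  define T where "T = {s \<in> S. e < s}"
  have T: "T \<subseteq> {0<..}" "reverse_well_ordered T"
    using S unfolding T_def reverse_well_ordered_def by auto
  \<comment> \<open>the representative of the closed ball of radius \<open>e\<close> around \<open>x\<close>\<close>
  define r where "r x = (SOME z. z \<in> mspace m \<and> mdist m x z \<le> e)" for x
  have r: "r x \<in> mspace m" "mdist m x (r x) \<le> e" if "x \<in> mspace m" for x
  proof -
    have "x \<in> mspace m \<and> mdist m x x \<le> e" using that e by (simp add: mdist_self)
    then show "r x \<in> mspace m" "mdist m x (r x) \<le> e"
      unfolding r_def by (metis (mono_tags, lifting) someI)+
  qed
  let ?N = "r ` mspace m"
  have N: "?N \<subseteq> mspace m" "?N \<noteq> {}" using r ne by auto
  have "branching m T ?N"
    unfolding branching_def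
  proof (intro ballI allI impI)
    fix y s A assume y: "y \<in> ?N" and s: "s \<in> T"
      and A: "finite A" "A \<subseteq> mspace m" "\<forall>a\<in>A. mdist m y a \<le> s"
    have yM: "y \<in> mspace m" using y N by blast
    have se: "s \<in> S" "e < s" using s by (auto simp: T_def)
    obtain z where z: "z \<in> mspace m" "\<forall>a\<in>insert y A. mdist m z a = s"
      using branching_ex[OF br yM se(1) A] by blast
    have "mdist m (r z) a = s" if a: "a \<in> insert y A" for a
    proof (rule ultra_isosceles[OF u r(1)[OF z(1)] z(1)])
      show "a \<in> mspace m" using a yM A(2) by blast
      show "mdist m (r z) z < s" using r(2)[OF z(1)] se(2) by (simp add: mdist_commute)
      show "mdist m z a = s" using z(2) a by blast
    qed
    with z show "\<exists>z\<in>?N. \<forall>a\<in>insert y A. mdist m z a = s" by blast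
  qed
  moreover have "c \<in> ?N \<rightarrow> {..<k}" using c N by blast
  ultimately obtain i Y where i: "i < k" and Y: "Y \<noteq> {}" "branching m T Y" "Y \<subseteq> {z \<in> ?N. c z = i}"
    using branching_pigeonhole[OF u T N(1) _ N(2)] by metis
  have YM: "Y \<subseteq> mspace m" using Y N by blast
  define V where "V = {x \<in> mspace m. \<exists>y\<in>Y. mdist m x y \<le> e}"
  have VM: "V \<subseteq> mspace m" by (auto simp: V_def)
  have "Y \<subseteq> V" using YM e by (auto simp: V_def mdist_self intro!: bexI)
  have Vcl: "x \<in> V" if v: "v \<in> V" and x: "x \<in> mspace m" "mdist m v x \<le> e" for v x
  proof -
    obtain y where y: "y \<in> Y" "mdist m v y \<le> e" "v \<in> mspace m" using v by (auto simp: V_def)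
    have "mdist m x y \<le> e"
      using ultra_le[OF u x(1) y(3), of y e] y x YM by (auto simp: mdist_commute)
    with x y show ?thesis by (auto simp: V_def)
  qed
  have brV: "branching m S V"
    unfolding branching_def
  proof (intro ballI allI impI)
    fix v s A assume v: "v \<in> V" and s: "s \<in> S"
      and A: "finite A" "A \<subseteq> mspace m" "\<forall>a\<in>A. mdist m v a \<le> s"
    have vM: "v \<in> mspace m" using v VM by blast
    show "\<exists>z\<in>V. \<forall>a\<in>insert v A. mdist m z a = s"
    proof (cases "s \<le> e")
      case True
      obtain z where z: "z \<in> mspace m" "\<forall>a\<in>insert v A. mdist m z a = s"
        using branching_ex[OF br vM s A] by blast
      with Vcl[OF v z(1)] True have "z \<in> V" by (simp add: mdist_commute)
      with z show ?thesis by blast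
    next
      case False
      then have sT: "s \<in> T" using s by (simp add: T_def)
      obtain y where y: "y \<in> Y" "mdist m v y \<le> e" using v by (auto simp: V_def)
      have yM: "y \<in> mspace m" using y YM by blast
      have yv: "mdist m y v \<le> s" using y False by (simp add: mdist_commute)
      have "mdist m y a \<le> s" if "a \<in> insert v A" for a
      proof (cases "a = v")
        case False
        with that have "a \<in> A" by simp
        with A ultra_le[OF u yM vM _ yv] show ?thesis by blast
      qed (use yv in simp)
      then obtain z where z: "z \<in> Y" "\<And>a. a \<in> insert v A \<Longrightarrow> mdist m z a = s"
        using branchingD[OF Y(2) y(1) sT, of "insert v A"] A vM by blast
      with \<open>Y \<subseteq> V\<close> show ?thesis by blast
    qed
  qed
  have "V \<noteq> {}" using Y(1) \<open>Y \<subseteq> V\<close> by blast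
  then have "isometric (submetric m V) m"
    using isometric_submetric_of_branching[OF g \<open>mcomplete_of m\<close> sep VM _ brV e] Vcl by blast
  moreover have "V \<subseteq> thickening m {x \<in> mspace m. c x = i} e"
    using Y(3) N(1) unfolding V_def thickening_def by blast
  ultimately show "\<exists>i<k. \<exists>Y\<subseteq>mspace m. isometric (submetric m Y) m \<and>
      Y \<subseteq> thickening m {x \<in> mspace m. c x = i} e"
    using i VM by blast
qed

section \<open>Necessity of the two conditions on the distances\<close>

definition distances :: "'a metric \<Rightarrow> real set" where
  "distances m = {mdist m x y | x y. x \<in> mspace m \<and> y \<in> mspace m \<and> x \<noteq> y}"

lemma distances_pos: "distances m \<subseteq> {0<..}"
  unfolding distances_def using mdist_nonneg[of m] by (auto simp: less_le)

text \<open>Every nonzero distance already occurs between two points of a dense set.\<close>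

lemma countable_distances:
  assumes u: "ultrametric m" and sep: "countably_dense m"
  shows "countable (distances m)"
proof -
  obtain D where D: "D \<subseteq> mspace m" "countable D"
    and dense: "\<And>x e. x \<in> mspace m \<Longrightarrow> e > 0 \<Longrightarrow> \<exists>a\<in>D. mdist m x a < e"
    using sep unfolding countably_dense_def by metis
  have "distances m \<subseteq> (\<lambda>(a, b). mdist m a b) ` (D \<times> D)"
  proof
    fix s assume s: "s \<in> distances m"
    then have s0: "s > 0" using distances_pos by auto
    obtain x y where xy: "x \<in> mspace m" "y \<in> mspace m" "mdist m x y = s"
      using s by (auto simp: distances_def)
    obtain a where a: "a \<in> D" "mdist m x a < s" using dense[OF xy(1) s0] by blast
    obtain b where b: "b \<in> D" "mdist m y b < s" using dense[OF xy(2) s0] by blast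
    have M: "a \<in> mspace m" "b \<in> mspace m" using a b D by auto
    have "mdist m a y = s"
      using ultra_isosceles[OF u M(1) xy(1,2), of s] a xy(3) by (simp add: mdist_commute)
    then have "mdist m b a = s"
      using ultra_isosceles[OF u M(2) xy(2) M(1), of s] b by (simp add: mdist_commute)
    with a b show "s \<in> (\<lambda>(a, b). mdist m a b) ` (D \<times> D)" by force
  qed
  then show ?thesis using D(2) by (meson countable_SIGMA countable_image countable_subset)
qed

text \<open>Approximate indivisibility in the form used against a particular colouring: a distance-preserving map
\<open>h\<close> of the space into itself whose values all lie near points of one colour.\<close>

lemma approx_indivisibleE:
  fixes c :: "'a \<Rightarrow> nat"
  assumes "approx_indivisible m" "e > 0" "k \<ge> 1" "c \<in> mspace m \<rightarrow> {..<k}"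
  obtains i h where "\<And>x. x \<in> mspace m \<Longrightarrow> h x \<in> mspace m"
    "\<And>x y. x \<in> mspace m \<Longrightarrow> y \<in> mspace m \<Longrightarrow> mdist m (h x) (h y) = mdist m x y"
    "\<And>x. x \<in> mspace m \<Longrightarrow> \<exists>z\<in>mspace m. c z = i \<and> mdist m (h x) z \<le> e"
proof -
  obtain i Y where Y: "Y \<subseteq> mspace m" "isometric (submetric m Y) m"
    "Y \<subseteq> thickening m {x \<in> mspace m. c x = i} e"
  proof -
    have "eps_indivisible e m" using assms(1,2) by (simp add: approx_indivisible_def)
    from this[unfolded eps_indivisible_def, rule_format, OF assms(3,4)] show thesis
      using that by blast
  qed
  obtain f where f: "bij_betw f Y (mspace m)"
    "\<And>x y. x \<in> Y \<Longrightarrow> y \<in> Y \<Longrightarrow> mdist m (f x) (f y) = mdist m x y"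
    using Y(2) unfolding isometric_def isometry_def by (auto simp: Int_absorb2[OF Y(1)])
  let ?h = "inv_into Y f"
  have h: "?h x \<in> Y" "f (?h x) = x" if "x \<in> mspace m" for x
    using f(1) that by (auto simp: bij_betw_def f_inv_into_f inv_into_into)
  show thesis
  proof (rule that[of ?h i])
    show "?h x \<in> mspace m" if "x \<in> mspace m" for x using h[OF that] Y(1) by blast
    show "mdist m (?h x) (?h y) = mdist m x y" if "x \<in> mspace m" "y \<in> mspace m" for x y
      using f(2)[OF h(1)[OF that(1)] h(1)[OF that(2)]] h(2)[OF that(1)] h(2)[OF that(2)] by simp
    show "\<exists>z\<in>mspace m. c z = i \<and> mdist m (?h x) z \<le> e" if "x \<in> mspace m" for x
      using h(1)[OF that] Y(3) unfolding thickening_def by blast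
  qed
qed

lemma point_homogeneous:
  assumes "ultrahomogeneous m" "x \<in> mspace m" "y \<in> mspace m"
  obtains g where "isometry m m g" "g x = y"
proof -
  have "isometry (submetric m {x}) (submetric m {y}) (\<lambda>_. y)"
    using assms by (auto simp: isometry_def bij_betw_def mdist_self)
  then have "\<exists>g. isometry m m g \<and> (\<forall>z\<in>{x}. g z = y)"
    using assms unfolding ultrahomogeneous_def
    by (metis empty_subsetI finite.emptyI finite.insertI insert_subset)
  with that show thesis by blast
qed

text \<open>Suppose that every point of some closed ball of radius \<open>s\<close> is at distance less than \<open>s\<close> from one of finitely many
points. By homogeneity, these can be copied into every closed ball of radius \<open>s\<close>, and a point is coloured
by the index of a copied point at distance less than \<open>s\<close>. With tolerance \<open>s / 2\<close>, two points of a nearly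
monochromatic copy that lie in the same closed ball are close to the same copied point, so their distance
is less than \<open>s\<close>. But a copy has to realise the distance \<open>s\<close>.\<close>

lemma branching_if_approx_indivisible:
  assumes h: "ultrahomogeneous m" and u: "ultrametric m" and ai: "approx_indivisible m"
  shows "branching m (distances m) (mspace m)"
  unfolding branching_def
proof (intro ballI allI impI)
  fix y0 s A0 assume y0: "y0 \<in> mspace m" and s: "s \<in> distances m"
    and A0: "finite A0" "A0 \<subseteq> mspace m" "\<forall>a\<in>A0. mdist m y0 a \<le> s"
  have s0: "s > 0" using s distances_pos by auto
  obtain p0 q0 where pq: "p0 \<in> mspace m" "q0 \<in> mspace m" "mdist m p0 q0 = s"
    using s by (auto simp: distances_def)
  let ?A = "insert y0 A0"
  have A: "finite ?A" "?A \<subseteq> mspace m" using A0 y0 by auto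
  have Ay: "mdist m y0 a \<le> s" if "a \<in> ?A" for a using that A0 s0 y0 by (auto simp: mdist_self)
  show "\<exists>z\<in>mspace m. \<forall>a\<in>?A. mdist m z a = s"
  proof (rule ccontr)
    assume no: "\<not> ?thesis"
    have cover0: "\<exists>a\<in>?A. mdist m z a < s" if z: "z \<in> mspace m" "mdist m y0 z \<le> s" for z
    proof -
      obtain a where a: "a \<in> ?A" "mdist m z a \<noteq> s" using no z(1) by blast
      have "mdist m z a \<le> s"
        using ultra_le[OF u z(1) y0, of a s] z(2) Ay[OF a(1)] a(1) A(2) by (auto simp: mdist_commute)
      with a show ?thesis by force
    qed
    \<comment> \<open>the common centre chosen for all points of one closed ball of radius \<open>s\<close>\<close>
    define r where "r x = (SOME z. z \<in> mspace m \<and> mdist m x z \<le> s)" for x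
    have r: "r x \<in> mspace m" "mdist m x (r x) \<le> s" if "x \<in> mspace m" for x
    proof -
      have "x \<in> mspace m \<and> mdist m x x \<le> s" using that s0 by (simp add: mdist_self)
      then show "r x \<in> mspace m" "mdist m x (r x) \<le> s"
        unfolding r_def by (metis (mono_tags, lifting) someI)+
    qed
    have req: "r x = r y" if xy: "x \<in> mspace m" "y \<in> mspace m" "mdist m x y \<le> s" for x y
    proof -
      have "mdist m x z \<le> s \<longleftrightarrow> mdist m y z \<le> s" if "z \<in> mspace m" for z
        using ultra_le[OF u xy(1,2) that, of s] ultra_le[OF u xy(2,1) that, of s] xy(3)
        by (auto simp: mdist_commute)
      then have "(\<lambda>z. z \<in> mspace m \<and> mdist m x z \<le> s) = (\<lambda>z. z \<in> mspace m \<and> mdist m y z \<le> s)"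
        by auto
      then show ?thesis unfolding r_def by simp
    qed
    have "\<forall>x\<in>mspace m. \<exists>g. isometry m m g \<and> g y0 = x"
      using point_homogeneous[OF h y0] by metis
    then obtain g where g: "\<And>x. x \<in> mspace m \<Longrightarrow> isometry m m (g x)"
      "\<And>x. x \<in> mspace m \<Longrightarrow> g x y0 = x"
      by metis
    have gM: "g x y \<in> mspace m" if "x \<in> mspace m" "y \<in> mspace m" for x y
      using g(1)[OF that(1)] that(2) unfolding isometry_def bij_betw_def by blast
    have cover: "\<exists>a\<in>?A. mdist m x (g (r x) a) < s" if x: "x \<in> mspace m" for x
    proof -
      note rx = r[OF x]
      obtain z where z: "z \<in> mspace m" "x = g (r x) z"
        using g(1)[OF rx(1)] x unfolding isometry_def bij_betw_def by blast
      have gd: "mdist m (g (r x) v) (g (r x) w) = mdist m v w"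
        if "v \<in> mspace m" "w \<in> mspace m" for v w
        using g(1)[OF rx(1)] that unfolding isometry_def by blast
      have "mdist m y0 z = mdist m (r x) x" using gd[OF y0 z(1)] g(2)[OF rx(1)] z(2) by simp
      then have "mdist m y0 z \<le> s" using rx(2) by (simp add: mdist_commute)
      then obtain a where a: "a \<in> ?A" "mdist m z a < s" using cover0[OF z(1)] by blast
      then have "mdist m x (g (r x) a) < s" using gd[OF z(1), of a] z(2) A(2) by auto
      with a show ?thesis by blast
    qed
    obtain n and e :: "nat \<Rightarrow> 'a" where e: "?A = e ` {..<n}"
      using finite_imp_nat_seg_image_inj_on[OF A(1)] by (auto simp: lessThan_def)
    have "\<forall>x\<in>mspace m. \<exists>i<n. mdist m x (g (r x) (e i)) < s"
      using cover unfolding e by blast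
    then obtain c where c: "\<And>x. x \<in> mspace m \<Longrightarrow> c x < n"
      "\<And>x. x \<in> mspace m \<Longrightarrow> mdist m x (g (r x) (e (c x))) < s"
      by metis
    have "n \<ge> 1" using e by (cases n) auto
    moreover have "c \<in> mspace m \<rightarrow> {..<n}" using c by auto
    ultimately obtain i f where f: "\<And>x. x \<in> mspace m \<Longrightarrow> f x \<in> mspace m"
      "\<And>x y. x \<in> mspace m \<Longrightarrow> y \<in> mspace m \<Longrightarrow> mdist m (f x) (f y) = mdist m x y"
      "\<And>x. x \<in> mspace m \<Longrightarrow> \<exists>z\<in>mspace m. c z = i \<and> mdist m (f x) z \<le> s / 2"
      using approx_indivisibleE[OF ai, of "s / 2" n c] s0 by (metis half_gt_zero)
    \<comment> \<open>the copied point that belongs to the ball of \<open>f p0\<close> and to the colour \<open>i\<close> of the copy\<close>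
    define a where "a = g (r (f p0)) (e i)"
    have near: "mdist m (f p) a < s \<and> a \<in> mspace m"
      if p: "p \<in> mspace m" "mdist m p0 p \<le> s" for p
    proof -
      obtain z where z: "z \<in> mspace m" "c z = i" "mdist m (f p) z \<le> s / 2" using f(3)[OF p(1)] by blast
      have "r (f p0) = r (f p)" using req[OF f(1)[OF pq(1)] f(1)[OF p(1)]] f(2)[OF pq(1) p(1)] p(2) by simp
      also have "\<dots> = r z" using req[OF f(1)[OF p(1)] z(1)] z(3) s0 by simp
      finally have az: "a = g (r z) (e (c z))" using z(2) by (simp add: a_def)
      have "e (c z) \<in> mspace m" using c(1)[OF z(1)] e A(2) by blast
      then have aM: "a \<in> mspace m" using az gM[OF r(1)[OF z(1)]] by simp
      have "mdist m z a < s" using c(2)[OF z(1)] az by simp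
      then show ?thesis
        using ultra_less[OF u f(1)[OF p(1)] z(1) aM, of s] z(3) s0 aM by simp
    qed
    have "mdist m (f p0) (f q0) < s"
      using ultra_less[OF u f(1)[OF pq(1)] _ f(1)[OF pq(2)], of a s] near[OF pq(1)] near[OF pq(2)]
        pq s0 by (simp add: mdist_commute mdist_self)
    then show False using f(2)[OF pq(1,2)] pq(3) by simp
  qed
qed

text \<open>Given a strictly increasing sequence \<open>s\<close> of distances, points are grouped into classes joined by distances
at most some \<open>s n\<close>, and coloured by the parity of the index that measures their distance to the base point
of their class. A point \<open>x\<close> of the space has points at each distance \<open>s n\<close>. In a copy, the image of \<open>x\<close>
is at distance at most some \<open>s N\<close> from its base point, so that for \<open>n > N\<close> the image of a point at
distance \<open>s n\<close> from \<open>x\<close> is at distance exactly \<open>s n\<close> from the same base point, and so is every point within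
\<open>s 0 / 2\<close> of that image. Hence both parities occur near the copy.\<close>

lemma reverse_well_ordered_if_approx_indivisible:
  assumes u: "ultrametric m" and br: "branching m S (mspace m)" and S: "S \<subseteq> {0<..}"
    and ne: "mspace m \<noteq> {}" and ai: "approx_indivisible m"
  shows "reverse_well_ordered S"
proof (rule ccontr)
  assume "\<not> reverse_well_ordered S"
  then obtain T where T: "T \<subseteq> S" "T \<noteq> {}" "\<And>t. t \<in> T \<Longrightarrow> \<exists>t'\<in>T. t < t'"
    unfolding reverse_well_ordered_def by (meson not_le)
  have "\<exists>s. \<forall>n. s n \<in> T \<and> s n < s (Suc n)"
    by (rule dependent_nat_choice) (use T in auto)
  then obtain s :: "nat \<Rightarrow> real" where sT: "\<And>n. s n \<in> T" and inc: "\<And>n. s n < s (Suc n)" by blast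
  have mono: "strict_mono s" using inc by (simp add: strict_mono_Suc_iff)
  have sle: "s i \<le> s j \<longleftrightarrow> i \<le> j" for i j using strict_mono_less_eq[OF mono] .
  have slt: "s i < s j \<longleftrightarrow> i < j" for i j using strict_mono_less[OF mono] .
  have spos: "s n > 0" for n using sT T(1) S by auto
  define near where "near x y \<longleftrightarrow> (\<exists>n. mdist m x y \<le> s n)" for x y
  have near_trans: "near x z"
    if M: "x \<in> mspace m" "y \<in> mspace m" "z \<in> mspace m" and xy: "near x y" and yz: "near y z" for x y z
  proof -
    obtain i j where ij: "mdist m x y \<le> s i" "mdist m y z \<le> s j" using xy yz by (auto simp: near_def)
    have "s i \<le> s (max i j)" "s j \<le> s (max i j)" using sle by simp_all
    with ij have "mdist m x z \<le> s (max i j)" by (intro ultra_le[OF u M]) linarith+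
    then show ?thesis unfolding near_def by blast
  qed
  have near_sym: "near x y \<longleftrightarrow> near y x" for x y by (simp add: near_def mdist_commute)
  \<comment> \<open>the base point of the class of \<open>x\<close>\<close>
  define r where "r x = (SOME z. z \<in> mspace m \<and> near x z)" for x
  have r: "r x \<in> mspace m" "near x (r x)" if "x \<in> mspace m" for x
  proof -
    have "near x x" using spos[of 0] mdist_self[OF that] unfolding near_def by (auto intro: less_imp_le)
    with that have "x \<in> mspace m \<and> near x x" by simp
    then show "r x \<in> mspace m" "near x (r x)"
      unfolding r_def by (metis (mono_tags, lifting) someI)+
  qed
  have req: "r x = r y" if xy: "x \<in> mspace m" "y \<in> mspace m" "near x y" for x y
  proof -
    have "near y x" using xy(3) near_sym by blast
    then have "(\<lambda>z. z \<in> mspace m \<and> near x z) = (\<lambda>z. z \<in> mspace m \<and> near y z)"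
      using near_trans[OF xy(1,2) _ xy(3)] near_trans[OF xy(2,1)] by blast
    then show ?thesis unfolding r_def by simp
  qed
  define c :: "'a \<Rightarrow> nat" where "c x = (LEAST n. mdist m x (r x) \<le> s n) mod 2" for x
  have "c \<in> mspace m \<rightarrow> {..<2}" by (auto simp: c_def)
  then obtain i f where f: "\<And>x. x \<in> mspace m \<Longrightarrow> f x \<in> mspace m"
      "\<And>x y. x \<in> mspace m \<Longrightarrow> y \<in> mspace m \<Longrightarrow> mdist m (f x) (f y) = mdist m x y"
      "\<And>x. x \<in> mspace m \<Longrightarrow> \<exists>z\<in>mspace m. c z = i \<and> mdist m (f x) z \<le> s 0 / 2"
    using approx_indivisibleE[OF ai, of "s 0 / 2" 2 c] spos[of 0] by (metis half_gt_zero one_le_numeral)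
  obtain x where x: "x \<in> mspace m" using ne by blast
  define e where "e = r (f x)"
  have eM: "e \<in> mspace m" using r(1)[OF f(1)[OF x]] by (simp add: e_def)
  obtain N where N: "mdist m (f x) e \<le> s N" using r(2)[OF f(1)[OF x]] by (auto simp: near_def e_def)
  have parity: "n mod 2 = i" if n: "n > N" for n
  proof -
    have "s n \<in> S" using sT T by blast
    then obtain y where y: "y \<in> mspace m" "mdist m y x = s n"
      using branching_ex[OF br x, of "s n" "{}"] by auto
    have lt: "mdist m (f x) e < s n" using N n slt[of N n] by simp
    have "mdist m e (f y) = s n"
      using ultra_isosceles[OF u eM f(1)[OF x] f(1)[OF y(1)], of "s n"] lt f(2)[OF x y(1)] y(2)
      by (simp add: mdist_commute)
    obtain z where z: "z \<in> mspace m" "c z = i" "mdist m (f y) z \<le> s 0 / 2"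
      using f(3)[OF y(1)] by blast
    have "mdist m (f y) z < s n" using z(3) spos[of 0] sle[of 0 n] by simp
    then have ze: "mdist m z e = s n"
      using ultra_isosceles[OF u z(1) f(1)[OF y(1)] eM, of "s n"] \<open>mdist m e (f y) = s n\<close>
      by (simp add: mdist_commute)
    have "near e z" using ze unfolding near_def by (metis mdist_commute order_refl)
    moreover have "near (f x) e" using N unfolding near_def by blast
    ultimately have "near (f x) z" using near_trans[OF f(1)[OF x] eM z(1)] by blast
    then have rz: "r z = e" using req[OF f(1)[OF x] z(1)] by (simp add: e_def)
    have "(LEAST k. mdist m z (r z) \<le> s k) = n"
      unfolding rz ze sle by (rule Least_equality) auto
    then show ?thesis using z(2) by (simp add: c_def)
  qed
  have "Suc N mod 2 = Suc (Suc N) mod 2" using parity[of "Suc N"] parity[of "Suc (Suc N)"] by simp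
  then show False by presburger
qed

section \<open>The equivalence\<close>

theorem theorem68:
  fixes X :: "'a metric"
  assumes "mspace X \<noteq> {}"
    and "mcomplete_of X"
    and "separable_space (mtopology_of X)"
    and "ultrahomogeneous X"
    and "ultrametric X"
  shows "approx_indivisible X \<longleftrightarrow>
    (\<exists>S::real set. S \<subseteq> {0<..} \<and> countable S \<and> reverse_well_ordered S \<and>
       isometric X (metric_completion (B_space S)))"
proof
  have dense: "countably_dense X" using assms(3) by (rule countably_dense_if_separable)
  {
    assume ai: "approx_indivisible X"
    let ?S = "distances X" and ?C = "metric_completion (B_space (distances X))"
    have br: "branching X ?S (mspace X)"
      using branching_if_approx_indivisible[OF assms(4,5) ai] .
    have countable: "countable ?S" using countable_distances[OF assms(5) dense] .
    have "generic ?S X"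
      using br assms(5) by (auto simp: generic_def distances_def)
    moreover have "generic ?S ?C"
      using generic_completion[OF generic_B_space] distances_pos by blast
    moreover have "countably_dense ?C"
      using countably_dense_completion countable_B_carrier[OF countable]
      by (metis distances_pos mspace_B_space)
    moreover have "mspace ?C \<noteq> {}"
    proof -
      have "(\<lambda>_. 0) \<in> mspace (B_space ?S)"
        by (simp add: mspace_B_space[OF distances_pos] B_carrier_def)
      from completion_embed_in[OF this] show ?thesis by auto
    qed
    ultimately have "isometric X ?C"
      using generic_unique assms(1,2) dense mcomplete_metric_completion by blast
    moreover have "reverse_well_ordered ?S"
      using reverse_well_ordered_if_approx_indivisible[OF assms(5) br distances_pos assms(1) ai] .
    ultimately show "\<exists>S::real set. S \<subseteq> {0<..} \<and> countable S \<and> reverse_well_ordered S \<and>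
        isometric X (metric_completion (B_space S))"
      using distances_pos countable by blast
  }
  assume "\<exists>S::real set. S \<subseteq> {0<..} \<and> countable S \<and> reverse_well_ordered S \<and>
      isometric X (metric_completion (B_space S))"
  then obtain S :: "real set" where S: "S \<subseteq> {0<..}" "reverse_well_ordered S"
    and iso: "isometric X (metric_completion (B_space S))" by blast
  have "generic S X"
    using generic_isometric[OF iso generic_completion[OF generic_B_space[OF S(1)] S(1)]] .
  then show "approx_indivisible X"
    using approx_indivisible_if_reverse_well_ordered S assms(1,2) dense by blast
qed

end
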